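(* Let $\mathcal{M}(t)\subset\mathbb{R}^3$, $t\in[t_0,t_0+T]$, be a material surface of $\dot x=v(x,t)$ with $\mathcal{M}(t_0)\subset U$. For a vector field $\rho$ on an open subset of $\mathbb{R}^3$ let $H_\rho(x)=\langle\nabla\times\rho(x),\rho(x)\rangle$ denote its helicity. (i) If $\mathcal{M}(t)$ is a repelling hyperbolic LCS over $[t_0,t_0+T]$, then $H_{\xi_3}(x_0)=0$ at all points $x_0\in\mathcal{M}(t_0)$. (ii) If $\mathcal{M}(t)$ is an attracting hyperbolic LCS over $[t_0,t_0+T]$, then $H_{\xi_1}(x_0)=0$ at all points $x_0\in\mathcal{M}(t_0)$. (iii) If $\mathcal{M}(t)$ is a shear LCS over $[t_0,t_0+T]$, then at all points $x_0\in\mathcal{M}(t_0)$ one has $H_{n_\pm}(x_0)=0$ for one choice of the sign in $\pm$, where $$n_{\pm}(x_0)=\sqrt{\frac{\sqrt{\lambda_1(x_0)}}{\sqrt{\lambda_1(x_0)}+\sqrt{\lambda_3(x_0)}}}\,\xi_1(x_0)\pm\sqrt{\frac{\sqrt{\lambda_3(x_0)}}{\sqrt{\lambda_1(x_0)}+\sqrt{\lambda_3(x_0)}}}\,\xi_3(x_0).$$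
   Context: Setting: $\dot x=v(x,t)$, $x\in D\subset\mathbb{R}^3$, $D$ compact, $t\in[t_0,t_0+T]$, $v$ smooth; $F_{t_0}^{t}(x_0)=x(t;t_0,x_0)$ is the flow map, assumed defined up to time $t_0+T$ at the initial conditions considered. The Cauchy--Green strain tensor is $C_{t_0}^{t_0+T}(x_0)=[\nabla F_{t_0}^{t_0+T}(x_0)]^*\nabla F_{t_0}^{t_0+T}(x_0)$, with eigenvalues $\lambda_1\le\lambda_2\le\lambda_3$ and corresponding orthonormal eigenvectors $\xi_1,\xi_2,\xi_3$. $U=\{x_0\in D: 0<\lambda_1(x_0)<\lambda_2(x_0)<\lambda_3(x_0)\}$, treated as an open set of initial conditions to which the discussion is restricted. On $U$ the $\xi_i$ are determined up to sign and are selected as smooth fields on small open sets; helicities are computed with such local smooth choices (helicity does not depend on an overall sign of the field; changing the relative orientation of $\xi_1$ and $\xi_3$ interchanges $n_+$ and $n_-$ up to an overall sign, so the sign in $\pm$ is understood relative to the local smooth choices). Material surface: a family $\mathcal{M}(t)=F_{t_0}^t(\mathcal{M}(t_0))$, where $\mathcal{M}(t_0)$ is a smooth two-dimensional surface. For a unit normal $n_0$ to $\mathcal{M}(t_0)$ at $x_0$, the advected unit normal is $n_{t_0+T}(x_0)=\dfrac{[\nabla F_{t_0}^{t_0+T}(x_0)]^{-*}n_0}{|[\nabla F_{t_0}^{t_0+T}(x_0)]^{-*}n_0|}$ (where $A^{-*}=(A^{-1})^*$). Normal repulsion: $\rho(x_0,n_0)=\langle n_{t_0+T}(x_0),\nabla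 F_{t_0}^{t_0+T}(x_0)n_0\rangle$. Tangential shear: $\sigma(x_0,n_0)=|\nabla F_{t_0}^{t_0+T}(x_0)n_0-\langle n_{t_0+T}(x_0),\nabla F_{t_0}^{t_0+T}(x_0)n_0\rangle n_{t_0+T}(x_0)|$. Definitions (over $[t_0,t_0+T]$; $n_0$ denotes the unit normal to $\mathcal{M}(t_0)$ at $x_0$). $\mathcal{M}(t)$ is a - repelling hyperbolic LCS if for any $x_0\in\mathcal{M}(t_0)$ and any other material surface $\hat{\mathcal{M}}(t)$ with $x_0\in\hat{\mathcal{M}}(t_0)$ and unit normal $\hat n_0\not\parallel n_0$ at $x_0$, one has $\rho(x_0,\hat n_0)<\rho(x_0,n_0)$ and $\rho(x_0,n_0)>1$; - attracting hyperbolic LCS if for any such $x_0$ and $\hat{\mathcal{M}}$, one has $\rho(x_0,\hat n_0)>\rho(x_0,n_0)$ and $\rho(x_0,n_0)<1$; - shear LCS if for any such $x_0$ and $\hat{\mathcal{M}}$, one has $\sigma(x_0,\hat n_0)\le\sigma(x_0,n_0)$. *)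

theory Defs
  imports "HOL-Analysis.Analysis"
begin

section \<open>Smooth maps and vector calculus\<close>

text \<open>Only used on open sets of finite-dimensional spaces, where continuity of all iterated
  directional derivatives up to order \<open>k\<close> is the usual \<open>C\<^sup>k\<close> condition.\<close>

primrec Ck_on :: "nat \<Rightarrow> 'a::real_normed_vector set \<Rightarrow> ('a \<Rightarrow> 'b::real_normed_vector) \<Rightarrow> bool" where
  "Ck_on 0 S f \<longleftrightarrow> continuous_on S f"
| "Ck_on (Suc k) S f \<longleftrightarrow> (\<forall>x\<in>S. f differentiable (at x)) \<and>
     (\<forall>h. Ck_on k S (\<lambda>x. frechet_derivative f (at x) h))"

definition smooth_on :: "'a::real_normed_vector set \<Rightarrow> ('a \<Rightarrow> 'b::real_normed_vector) \<Rightarrow> bool" where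
  "smooth_on S f \<longleftrightarrow> (\<forall>k. Ck_on k S f)"

definition curl :: "(real^3 \<Rightarrow> real^3) \<Rightarrow> real^3 \<Rightarrow> real^3" where
  "curl r x = (let J = jacobian r (at x) in
     vector [J$3$2 - J$2$3, J$1$3 - J$3$1, J$2$1 - J$1$2])"

definition helicity :: "(real^3 \<Rightarrow> real^3) \<Rightarrow> real^3 \<Rightarrow> real" where
  "helicity r x = curl r x \<bullet> r x"


section \<open>Surfaces\<close>

definition local_parametrization ::
    "(real^3) set \<Rightarrow> (real^2) set \<Rightarrow> (real^2 \<Rightarrow> real^3) \<Rightarrow> bool" where
  "local_parametrization S V \<phi> \<longleftrightarrow> open V \<and> smooth_on V \<phi> \<and>
     (\<forall>u\<in>V. inj (frechet_derivative \<phi> (at u))) \<and>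
     openin (top_of_set S) (\<phi> ` V) \<and> (\<exists>\<psi>. homeomorphism V (\<phi> ` V) \<phi> \<psi>)"

text \<open>Embedded surfaces without boundary.\<close>

definition smooth_surface :: "(real^3) set \<Rightarrow> bool" where
  "smooth_surface S \<longleftrightarrow> (\<forall>p\<in>S. \<exists>V \<phi>. local_parametrization S V \<phi> \<and> p \<in> \<phi> ` V)"

text \<open>The range of the derivative at \<open>u\<close>, i.e. the tangent plane at \<open>p\<close>, is the same for all
  local parametrizations with \<open>\<phi> u = p\<close>. There are exactly two unit normals, \<open>n\<close> and \<open>- n\<close>.\<close>

definition unit_normal :: "(real^3) set \<Rightarrow> real^3 \<Rightarrow> real^3 \<Rightarrow> bool" where
  "unit_normal S p n \<longleftrightarrow> norm n = 1 \<and>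
     (\<exists>V \<phi> u. local_parametrization S V \<phi> \<and> u \<in> V \<and> \<phi> u = p \<and>
        (\<forall>h. n \<bullet> frechet_derivative \<phi> (at u) h = 0))"


section \<open>The flow\<close>

text \<open>Smoothness on the compact set \<open>D \<times> {t0..t0 + T}\<close> means existence of a smooth extension
  to an open neighbourhood.\<close>

definition smooth_velocity ::
    "(real^3) set \<Rightarrow> (real^3 \<Rightarrow> real \<Rightarrow> real^3) \<Rightarrow> real \<Rightarrow> real \<Rightarrow> bool" where
  "smooth_velocity D v t0 T \<longleftrightarrow>
     (\<exists>W w. open W \<and> D \<times> {t0..t0 + T} \<subseteq> W \<and> smooth_on W w \<and>
        (\<forall>x\<in>D. \<forall>t\<in>{t0..t0 + T}. v x t = w (x, t)))"

definition trajectory ::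
    "(real^3) set \<Rightarrow> (real^3 \<Rightarrow> real \<Rightarrow> real^3) \<Rightarrow> real \<Rightarrow> real \<Rightarrow> (real \<Rightarrow> real^3) \<Rightarrow> bool" where
  "trajectory D v t0 T x \<longleftrightarrow>
     (\<forall>t\<in>{t0..t0 + T}. x t \<in> D \<and>
        (x has_vector_derivative v (x t) t) (at t within {t0..t0 + T}))"

text \<open>The initial conditions at which the flow map is defined up to time \<open>t0 + T\<close>.\<close>

definition flow_domain ::
    "(real^3) set \<Rightarrow> (real^3 \<Rightarrow> real \<Rightarrow> real^3) \<Rightarrow> real \<Rightarrow> real \<Rightarrow> (real^3) set" where
  "flow_domain D v t0 T = {x0. \<exists>x. trajectory D v t0 T x \<and> x t0 = x0}"

definition flow_map ::
    "(real^3) set \<Rightarrow> (real^3 \<Rightarrow> real \<Rightarrow> real^3) \<Rightarrow> real \<Rightarrow> real \<Rightarrow> real \<Rightarrow> real^3 \<Rightarrow> real^3" where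
  "flow_map D v t0 T t x0 = (THE y. \<exists>x. trajectory D v t0 T x \<and> x t0 = x0 \<and> x t = y)"

definition flow_gradient ::
    "(real^3) set \<Rightarrow> (real^3 \<Rightarrow> real \<Rightarrow> real^3) \<Rightarrow> real \<Rightarrow> real \<Rightarrow> real^3 \<Rightarrow> real^3^3" where
  "flow_gradient D v t0 T x0 = jacobian (flow_map D v t0 T (t0 + T)) (at x0)"

definition cauchy_green ::
    "(real^3) set \<Rightarrow> (real^3 \<Rightarrow> real \<Rightarrow> real^3) \<Rightarrow> real \<Rightarrow> real \<Rightarrow> real^3 \<Rightarrow> real^3^3" where
  "cauchy_green D v t0 T x0 =
     transpose (flow_gradient D v t0 T x0) ** flow_gradient D v t0 T x0"

text \<open>The eigenvalues of a symmetric matrix in increasing order, with multiplicity.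
  In the index type \<open>3\<close> the numeral \<open>3\<close> equals \<open>0\<close>, so the order is spelled out.\<close>

definition orthonormal_eigenbasis :: "real^3^3 \<Rightarrow> real^3 \<Rightarrow> (3 \<Rightarrow> real^3) \<Rightarrow> bool" where
  "orthonormal_eigenbasis A l e \<longleftrightarrow>
     (\<forall>i j. e i \<bullet> e j = (if i = j then 1 else 0)) \<and> (\<forall>i. A *v e i = l$i *\<^sub>R e i)"

definition ordered_eigenvalues :: "real^3^3 \<Rightarrow> real^3" where
  "ordered_eigenvalues A =
     (THE l. l$1 \<le> l$2 \<and> l$2 \<le> l$3 \<and> (\<exists>e. orthonormal_eigenbasis A l e))"

definition strain_eigenvalues ::
    "(real^3) set \<Rightarrow> (real^3 \<Rightarrow> real \<Rightarrow> real^3) \<Rightarrow> real \<Rightarrow> real \<Rightarrow> real^3 \<Rightarrow> real^3" where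
  "strain_eigenvalues D v t0 T x0 = ordered_eigenvalues (cauchy_green D v t0 T x0)"

text \<open>The gradient of the flow map is taken at interior points of its domain, which is contained
  in \<open>D\<close>. The set is open when the velocity is smooth.\<close>

definition simple_strain_set ::
    "(real^3) set \<Rightarrow> (real^3 \<Rightarrow> real \<Rightarrow> real^3) \<Rightarrow> real \<Rightarrow> real \<Rightarrow> (real^3) set" where
  "simple_strain_set D v t0 T =
     {x0 \<in> interior (flow_domain D v t0 T).
        let l = strain_eigenvalues D v t0 T x0 in 0 < l$1 \<and> l$1 < l$2 \<and> l$2 < l$3}"

text \<open>A smooth selection, on an open set \<open>V\<close>, of orthonormal eigenvectors
  \<open>\<xi> 1\<close>, \<open>\<xi> 2\<close>, \<open>\<xi> 3\<close>.\<close>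

definition smooth_strain_frame ::
    "(real^3) set \<Rightarrow> (real^3 \<Rightarrow> real \<Rightarrow> real^3) \<Rightarrow> real \<Rightarrow> real \<Rightarrow>
     (real^3) set \<Rightarrow> (3 \<Rightarrow> real^3 \<Rightarrow> real^3) \<Rightarrow> bool" where
  "smooth_strain_frame D v t0 T V \<xi> \<longleftrightarrow>
     open V \<and> V \<subseteq> simple_strain_set D v t0 T \<and> (\<forall>i. smooth_on V (\<xi> i)) \<and>
     (\<forall>x\<in>V. orthonormal_eigenbasis (cauchy_green D v t0 T x)
        (strain_eigenvalues D v t0 T x) (\<lambda>i. \<xi> i x))"

text \<open>The field \<open>n\<^sub>\<plusminus>\<close>; the sign is \<open>s = 1\<close> or \<open>s = -1\<close>.\<close>

definition shear_normal ::
    "(real^3) set \<Rightarrow> (real^3 \<Rightarrow> real \<Rightarrow> real^3) \<Rightarrow> real \<Rightarrow> real \<Rightarrow>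
     (3 \<Rightarrow> real^3 \<Rightarrow> real^3) \<Rightarrow> real \<Rightarrow> real^3 \<Rightarrow> real^3" where
  "shear_normal D v t0 T \<xi> s x =
     (let l = strain_eigenvalues D v t0 T x in
        sqrt (sqrt (l$1) / (sqrt (l$1) + sqrt (l$3))) *\<^sub>R \<xi> 1 x
        + (s * sqrt (sqrt (l$3) / (sqrt (l$1) + sqrt (l$3)))) *\<^sub>R \<xi> 3 x)"


section \<open>Material surfaces and Lagrangian coherent structures\<close>

definition material_surface ::
    "(real^3) set \<Rightarrow> (real^3 \<Rightarrow> real \<Rightarrow> real^3) \<Rightarrow> real \<Rightarrow> real \<Rightarrow> (real \<Rightarrow> (real^3) set) \<Rightarrow> bool" where
  "material_surface D v t0 T M \<longleftrightarrow>
     smooth_surface (M t0) \<and> M t0 \<subseteq> flow_domain D v t0 T \<and>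
     (\<forall>t\<in>{t0..t0 + T}. M t = flow_map D v t0 T t ` M t0)"

definition advected_normal ::
    "(real^3) set \<Rightarrow> (real^3 \<Rightarrow> real \<Rightarrow> real^3) \<Rightarrow> real \<Rightarrow> real \<Rightarrow> real^3 \<Rightarrow> real^3 \<Rightarrow> real^3" where
  "advected_normal D v t0 T x0 n0 =
     (let m = transpose (matrix_inv (flow_gradient D v t0 T x0)) *v n0 in m /\<^sub>R norm m)"

definition normal_repulsion ::
    "(real^3) set \<Rightarrow> (real^3 \<Rightarrow> real \<Rightarrow> real^3) \<Rightarrow> real \<Rightarrow> real \<Rightarrow> real^3 \<Rightarrow> real^3 \<Rightarrow> real" where
  "normal_repulsion D v t0 T x0 n0 =
     advected_normal D v t0 T x0 n0 \<bullet> (flow_gradient D v t0 T x0 *v n0)"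

definition tangential_shear ::
    "(real^3) set \<Rightarrow> (real^3 \<Rightarrow> real \<Rightarrow> real^3) \<Rightarrow> real \<Rightarrow> real \<Rightarrow> real^3 \<Rightarrow> real^3 \<Rightarrow> real" where
  "tangential_shear D v t0 T x0 n0 =
     (let n = advected_normal D v t0 T x0 n0; w = flow_gradient D v t0 T x0 *v n0
      in norm (w - (n \<bullet> w) *\<^sub>R n))"

text \<open>\<open>m\<close> is a unit normal at \<open>x0\<close>, not parallel to \<open>n\<close>, of a material surface through \<open>x0\<close>.\<close>

definition competing_normal ::
    "(real^3) set \<Rightarrow> (real^3 \<Rightarrow> real \<Rightarrow> real^3) \<Rightarrow> real \<Rightarrow> real \<Rightarrow>
     real^3 \<Rightarrow> real^3 \<Rightarrow> real^3 \<Rightarrow> bool" where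
  "competing_normal D v t0 T x0 n m \<longleftrightarrow>
     (\<exists>N. material_surface D v t0 T N \<and> x0 \<in> N t0 \<and> unit_normal (N t0) x0 m \<and>
        \<not> collinear {0, n, m})"

definition repelling_LCS ::
    "(real^3) set \<Rightarrow> (real^3 \<Rightarrow> real \<Rightarrow> real^3) \<Rightarrow> real \<Rightarrow> real \<Rightarrow> (real \<Rightarrow> (real^3) set) \<Rightarrow> bool" where
  "repelling_LCS D v t0 T M \<longleftrightarrow>
     (\<forall>x0\<in>M t0. \<forall>n. unit_normal (M t0) x0 n \<longrightarrow>
        (\<forall>m. competing_normal D v t0 T x0 n m \<longrightarrow>
           normal_repulsion D v t0 T x0 m < normal_repulsion D v t0 T x0 n) \<and>
        normal_repulsion D v t0 T x0 n > 1)"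

definition attracting_LCS ::
    "(real^3) set \<Rightarrow> (real^3 \<Rightarrow> real \<Rightarrow> real^3) \<Rightarrow> real \<Rightarrow> real \<Rightarrow> (real \<Rightarrow> (real^3) set) \<Rightarrow> bool" where
  "attracting_LCS D v t0 T M \<longleftrightarrow>
     (\<forall>x0\<in>M t0. \<forall>n. unit_normal (M t0) x0 n \<longrightarrow>
        (\<forall>m. competing_normal D v t0 T x0 n m \<longrightarrow>
           normal_repulsion D v t0 T x0 m > normal_repulsion D v t0 T x0 n) \<and>
        normal_repulsion D v t0 T x0 n < 1)"

definition shear_LCS ::
    "(real^3) set \<Rightarrow> (real^3 \<Rightarrow> real \<Rightarrow> real^3) \<Rightarrow> real \<Rightarrow> real \<Rightarrow> (real \<Rightarrow> (real^3) set) \<Rightarrow> bool" where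
  "shear_LCS D v t0 T M \<longleftrightarrow>
     (\<forall>x0\<in>M t0. \<forall>n. unit_normal (M t0) x0 n \<longrightarrow>
        (\<forall>m. competing_normal D v t0 T x0 n m \<longrightarrow>
           tangential_shear D v t0 T x0 m \<le> tangential_shear D v t0 T x0 n))"

end

theory Submission
  imports Defs
begin

text \<open>At a point of a coherent structure every direction is the normal of some small planar material
  disc, so the unit normal \<open>n\<close> maximises (minimises) \<open>\<rho>\<close> or maximises \<open>\<sigma>\<close> over the whole unit sphere.
  In the eigenbasis \<open>\<rho> = (\<Sum> n\<^sub>i\<^sup>2 / \<lambda>\<^sub>i) powr (-1/2)\<close> and \<open>\<sigma>\<^sup>2 = \<Sum> \<lambda>\<^sub>i n\<^sub>i\<^sup>2 - \<rho>\<^sup>2\<close>, hence \<open>n\<close> is parallel to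
  \<open>\<xi>\<^sub>3\<close>, \<open>\<xi>\<^sub>1\<close> or one of \<open>n\<^sub>\<plusminus>\<close>. A differentiable field normal to a surface has zero helicity on it, by the
  symmetry of second derivatives. The field \<open>n\<^sub>\<plusminus>\<close> involves the eigenvalues, so for it one needs that the
  flow map is twice differentiable. The sign is that of \<open>(n \<bullet> \<xi>\<^sub>1) (n \<bullet> \<xi>\<^sub>3)\<close>, which is continuous and
  nowhere zero along the surface.\<close>

section \<open>Estimates for differential equations and \<open>C\<^sup>1\<close> maps\<close>

text \<open>Three obstacles shape the proof. First, \<open>smooth_strain_frame\<close> makes the
  fields \<open>\<xi> i\<close> smooth but says nothing about the eigenvalues. They are recovered as
  |F \<xi>_i|^2, with F the flow gradient, so their differentiability is inherited from F. Second,
  the flow is given only pointwise, by trajectories inside the compact set \<open>D\<close>, and the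
  velocity is smooth through an extension to an open set. Dependence on the initial point therefore
  has to be extracted from Gronwall estimates; since \<open>D\<close> need not be convex, the
  required Lipschitz and linearization bounds on compact sets are prepared separately. Third,
  \<open>unit_normal\<close> asks for some parametrization, so a sign attached to a point is
  meaningful only once the tangent plane is known not to depend on it. Local constancy of that sign
  serves twice: it makes one fixed field normal on a whole neighbourhood of each point, as the
  helicity argument requires, and it gives a single sign on each connected piece.\<close>

text \<open>The squared norm, damped by an exponential and corrected by a linear term, is
  nonincreasing. Squaring keeps everything differentiable where \<open>g\<close> vanishes. The
  constant is not sharp; only its independence of \<open>g\<close> and \<eta> matters later.\<close>

lemma gronwall_norm:
  fixes g :: "real \<Rightarrow> 'a::real_inner"
  assumes der: "\<And>s. s \<in> {a..b} \<Longrightarrow> (g has_vector_derivative g' s) (at s within {a..b})"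
    and bnd: "\<And>s. s \<in> {a..b} \<Longrightarrow> norm (g' s) \<le> L * norm (g s) + \<eta>"
    and L: "0 \<le> L" and \<eta>: "0 \<le> \<eta>" and t: "t \<in> {a..b}"
  shows "norm (g t) \<le> exp ((L + 1) * (b - a)) * (norm (g a) + \<eta>)"
proof -
  \<comment> \<open>The part 2L cancels the growth of the squared norm; the extra 1 absorbs the
    cross term, since 2 |g| \<eta> - |g|^2 \<le> \<eta>^2.\<close>
  define c where "c = 2 * L + 1"
  define q where "q = (\<lambda>s. exp (- c * (s - a)) * (g s \<bullet> g s) - \<eta>\<^sup>2 * (s - a))"
  define q' where "q' = (\<lambda>s. exp (- c * (s - a)) * (2 * (g s \<bullet> g' s) - c * (g s \<bullet> g s)) - \<eta>\<^sup>2)"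
  have dq: "(q has_derivative (\<lambda>h. h * q' s)) (at s within {a..t})" if s: "s \<in> {a..t}" for s
  proof -
    have "(g has_derivative (\<lambda>h. h *\<^sub>R g' s)) (at s within {a..t})"
      using der[of s] s t unfolding has_vector_derivative_def
      by (auto intro: has_derivative_subset)
    then show ?thesis
      unfolding q_def q'_def
      by (auto intro!: derivative_eq_intros simp: algebra_simps inner_commute)
  qed
  have neg: "q' s \<le> 0" if s: "s \<in> {a..t}" for s
  proof -
    have sab: "s \<in> {a..b}" using s t by auto
    have "g s \<bullet> g' s \<le> norm (g s) * norm (g' s)" by (rule norm_cauchy_schwarz)
    also have "\<dots> \<le> norm (g s) * (L * norm (g s) + \<eta>)"
      by (intro mult_left_mono bnd[OF sab] norm_ge_zero)
    finally have 1: "g s \<bullet> g' s \<le> norm (g s) * (L * norm (g s) + \<eta>)" .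
    have "2 * (g s \<bullet> g' s) - c * (g s \<bullet> g s) \<le> 2 * (norm (g s) * \<eta>) - (norm (g s))\<^sup>2"
      using 1 unfolding c_def dot_square_norm by (simp add: algebra_simps power2_eq_square)
    also have "\<dots> \<le> \<eta>\<^sup>2"
      using zero_le_power2[of "norm (g s) - \<eta>"] by (simp add: power2_eq_square algebra_simps)
    finally have "exp (- c * (s - a)) * (2 * (g s \<bullet> g' s) - c * (g s \<bullet> g s))
        \<le> exp (- c * (s - a)) * \<eta>\<^sup>2"
      by (intro mult_left_mono) auto
    also have "\<dots> \<le> 1 * \<eta>\<^sup>2"
    proof (intro mult_right_mono)
      have "0 \<le> c * (s - a)" using s L by (intro mult_nonneg_nonneg) (auto simp: c_def)
      then show "exp (- c * (s - a)) \<le> 1" by simp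
    qed simp
    finally show ?thesis by (simp add: q'_def)
  qed
  obtain s where s: "s \<in> {a..t}" "q t - q a = (t - a) * q' s"
    using mvt_very_simple[of a t q "\<lambda>s h. h * q' s"] dq t by auto
  have "q t \<le> q a"
    using s neg[OF s(1)] by (smt (verit, best) atLeastAtMost_iff mult_nonneg_nonpos t)
  then have "exp (- c * (t - a)) * (norm (g t))\<^sup>2 \<le> (norm (g a))\<^sup>2 + \<eta>\<^sup>2 * (t - a)"
    by (simp add: q_def dot_square_norm)
  then have "exp (c * (t - a)) * (exp (- c * (t - a)) * (norm (g t))\<^sup>2)
      \<le> exp (c * (t - a)) * ((norm (g a))\<^sup>2 + \<eta>\<^sup>2 * (t - a))"
    by (intro mult_left_mono) auto
  then have "(norm (g t))\<^sup>2 \<le> exp (c * (t - a)) * ((norm (g a))\<^sup>2 + \<eta>\<^sup>2 * (t - a))"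
    by (simp add: mult.assoc[symmetric] exp_add[symmetric])
  \<comment> \<open>The factor exp (b - a) dominates both 1 and t - a, and c + 1 = 2 (L + 1) makes
    the total exponent twice the one claimed.\<close>
  also have "\<dots> \<le> exp (c * (b - a)) * ((norm (g a))\<^sup>2 * exp (b - a) + \<eta>\<^sup>2 * exp (b - a))"
  proof (intro mult_mono add_mono)
    have "b - a \<le> exp (b - a)" using exp_ge_add_one_self[of "b - a"] by linarith
    then show "t - a \<le> exp (b - a)" using t by auto
    show "(norm (g a))\<^sup>2 \<le> (norm (g a))\<^sup>2 * exp (b - a)"
      using t by (simp add: mult_left_le_one_le mult_le_cancel_left1)
  qed (use t L c_def in \<open>auto intro!: mult_mono\<close>)
  also have "\<dots> = exp (2 * ((L + 1) * (b - a))) * ((norm (g a))\<^sup>2 + \<eta>\<^sup>2)"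
  proof -
    have "exp (2 * ((L + 1) * (b - a))) = exp (c * (b - a)) * exp (b - a)"
      unfolding exp_add[symmetric] c_def by (simp add: algebra_simps)
    then show ?thesis by (simp add: algebra_simps)
  qed
  also have "\<dots> \<le> exp (2 * ((L + 1) * (b - a))) * (norm (g a) + \<eta>)\<^sup>2"
    using \<eta> by (intro mult_left_mono) (auto simp: power2_sum)
  also have "\<dots> = (exp ((L + 1) * (b - a)) * (norm (g a) + \<eta>))\<^sup>2"
    by (simp add: power_mult_distrib exp_double)
  finally show ?thesis
    using \<eta> by (auto intro: power2_le_imp_le)
qed

lemma Ck_on_has_derivative:
  assumes "Ck_on (Suc k) S f" "x \<in> S"
  shows "(f has_derivative frechet_derivative f (at x)) (at x)"
  using assms by (auto simp: frechet_derivative_works)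

lemma Ck_on_imp_continuous_on:
  assumes "Ck_on k S f"
  shows "continuous_on S f"
  using assms
  by (cases k) (auto intro!: continuous_at_imp_continuous_on differentiable_imp_continuous_within)

lemma C1_onI:
  assumes "open S" "\<And>x. x \<in> S \<Longrightarrow> (f has_derivative F x) (at x)"
    "\<And>h. continuous_on S (\<lambda>x. F x h)"
  shows "Ck_on (Suc 0) S f"
proof -
  have eq: "frechet_derivative f (at x) = F x" if "x \<in> S" for x
    using assms(2)[OF that] by (metis frechet_derivative_at)
  have "continuous_on S (\<lambda>x. frechet_derivative f (at x) h)" for h
    using assms(3)[of h] eq by (auto cong: continuous_on_cong)
  then show ?thesis
    using assms(2) by (auto simp: differentiable_def)
qed

text \<open>\<open>Q\<close> need not be convex. Close points are joined by a segment inside the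
  closed r-neighbourhood \<open>R\<close> of \<open>Q\<close>, where the mean value inequality
  applies; distant points are handled by boundedness of \<open>f\<close>. The linearization error is
  uniform because the derivative is uniformly continuous on \<open>R\<close>.\<close>

lemma C1_compact_bounds:
  fixes f :: "'a::euclidean_space \<Rightarrow> 'b::real_normed_vector"
  assumes f: "Ck_on (Suc 0) W f" and W: "open W" and Q: "compact Q" "Q \<subseteq> W"
  obtains L where "0 \<le> L"
    "\<And>p q. p \<in> Q \<Longrightarrow> q \<in> Q \<Longrightarrow> norm (f q - f p) \<le> L * norm (q - p)"
    "\<And>p h. p \<in> Q \<Longrightarrow> norm (frechet_derivative f (at p) h) \<le> L * norm h"
    "\<And>e. 0 < e \<Longrightarrow> \<exists>d>0. \<forall>p\<in>Q. \<forall>q\<in>Q. norm (q - p) \<le> d \<longrightarrow>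
        norm (f q - f p - frechet_derivative f (at p) (q - p)) \<le> e * norm (q - p)"
proof (cases "Q = {}")
  case True
  then show ?thesis by (intro that[of 0]) (auto intro: exI[of _ 1])
next
  case ne: False
  \<comment> \<open>\<open>Ck_on\<close> gives continuity of the derivative in each fixed direction;
    as a bounded linear map it is then continuous in operator norm, by finite dimension.\<close>
  define F where "F = (\<lambda>p. Blinfun (frechet_derivative f (at p)))"
  have der: "(f has_derivative frechet_derivative f (at p)) (at p)" if "p \<in> W" for p
    using f that by (rule Ck_on_has_derivative)
  have F: "blinfun_apply (F p) = frechet_derivative f (at p)" if "p \<in> W" for p
    unfolding F_def by (rule bounded_linear_Blinfun_apply) (rule has_derivative_bounded_linear[OF der[OF that]])
  have contF: "continuous_on W F"
  proof (rule continuous_on_blinfun_componentwise)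
    fix i
    have "continuous_on W (\<lambda>x. frechet_derivative f (at x) i)" using f by simp
    then show "continuous_on W (\<lambda>x. blinfun_apply (F x) i)"
      by (rule continuous_on_eq) (simp add: F)
  qed
  obtain r where r: "r > 0" "{x. infdist x Q \<le> r} \<subseteq> W"
    using compact_in_open_separated[OF ne Q(1) W Q(2)] by blast
  define R where "R = {x. infdist x Q \<le> r}"
  have R: "compact R" "R \<subseteq> W" using compact_infdist_le[OF ne Q(1) r(1)] r by (auto simp: R_def)
  have cb: "cball p s \<subseteq> R" if "p \<in> Q" "s \<le> r" for p s
  proof
    fix x assume "x \<in> cball p s"
    then have "dist x p \<le> r" using that by (simp add: dist_commute)
    then show "x \<in> R" unfolding R_def using infdist_le2[OF that(1)] by blast
  qed
  have onF: "onorm (frechet_derivative f (at p)) = norm (F p)" if "p \<in> W" for p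
    using F[OF that] by (metis norm_blinfun.rep_eq)
  have "bounded (F ` R)"
    using R contF by (intro compact_imp_bounded compact_continuous_image) (auto intro: continuous_on_subset)
  then obtain B where B: "B > 0" "\<And>p. p \<in> R \<Longrightarrow> norm (F p) \<le> B"
    unfolding bounded_pos by auto
  have derR: "(f has_derivative frechet_derivative f (at x)) (at x within S)" if "x \<in> R" for x S
    using der that R(2) by (blast intro: has_derivative_at_withinI)
  have BR: "onorm (frechet_derivative f (at x)) \<le> B" if "x \<in> R" for x
    using B(2)[OF that] onF[of x] that R(2) by (metis subsetD)
  have "bounded (f ` Q)"
    using Q Ck_on_imp_continuous_on[OF f]
    by (intro compact_imp_bounded compact_continuous_image) (auto intro: continuous_on_subset)
  then obtain N where N: "N > 0" "\<And>p. p \<in> Q \<Longrightarrow> norm (f p) \<le> N"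
    unfolding bounded_pos by auto
  \<comment> \<open>\<open>B\<close> serves pairs at distance at most \<open>r\<close>; 2N/r serves
    the others, whose values differ by at most 2N.\<close>
  define L where "L = max B (2 * N / r)"
  show ?thesis
  proof (rule that[of L])
    show "0 \<le> L" using B by (simp add: L_def)
  next
    fix p q assume pq: "p \<in> Q" "q \<in> Q"
    show "norm (f q - f p) \<le> L * norm (q - p)"
    proof (cases "norm (q - p) \<le> r")
      case True
      have "norm (f q - f p) \<le> B * norm (q - p)"
      proof (rule differentiable_bound)
        show "convex (cball p r)" by simp
        show "(f has_derivative frechet_derivative f (at x)) (at x within cball p r)" if "x \<in> cball p r" for x
          using that cb[OF pq(1) order_refl] derR by blast
        show "onorm (frechet_derivative f (at x)) \<le> B" if "x \<in> cball p r" for x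
          using that cb[OF pq(1) order_refl] BR by blast
      qed (use True r pq in \<open>auto simp: dist_norm norm_minus_commute\<close>)
      also have "\<dots> \<le> L * norm (q - p)" by (intro mult_right_mono) (auto simp: L_def)
      finally show ?thesis .
    next
      case False
      have "norm (f q - f p) \<le> 2 * N / r * r"
        using N(2)[OF pq(1)] N(2)[OF pq(2)] norm_triangle_ineq4[of "f q" "f p"] r by auto
      also have "\<dots> \<le> L * norm (q - p)"
        using False r N B by (intro mult_mono) (auto simp: L_def)
      finally show ?thesis .
    qed
  next
    fix p h assume p: "p \<in> Q"
    then have pR: "p \<in> R" "p \<in> W" using Q cb[of p 0] r by auto
    have "norm (frechet_derivative f (at p) h) \<le> norm (F p) * norm h"
      using norm_blinfun[of "F p" h] F pR by simp
    also have "\<dots> \<le> L * norm h" using B(2)[OF pR(1)] by (intro mult_right_mono) (auto simp: L_def)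
    finally show "norm (frechet_derivative f (at p) h) \<le> L * norm h" .
  next
    fix e :: real assume e: "0 < e"
    have "uniformly_continuous_on R F"
      using R contF by (intro compact_uniformly_continuous) (auto intro: continuous_on_subset)
    then obtain d0 where d0: "d0 > 0" "\<And>p q. p \<in> R \<Longrightarrow> q \<in> R \<Longrightarrow> dist q p < d0 \<Longrightarrow> dist (F q) (F p) < e"
      using e unfolding uniformly_continuous_on_def by metis
    define d where "d = min r (d0 / 2)"
    have d: "d > 0" "d \<le> r" "d < d0" using r d0 by (auto simp: d_def)
    have "norm (f q - f p - frechet_derivative f (at p) (q - p)) \<le> e * norm (q - p)"
      if pq: "p \<in> Q" "q \<in> Q" "norm (q - p) \<le> d" for p q
    proof -
      have sub: "cball p d \<subseteq> R" using cb pq d by auto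
      have "norm (f q - f p - frechet_derivative f (at p) (q - p)) \<le> norm (q - p) * e"
      proof (rule differentiable_bound_linearization)
        fix t :: real assume "t \<in> {0..1}"
        then have "norm (t *\<^sub>R (q - p)) \<le> d"
          using pq(3) by simp (smt (verit) mult_left_le_one_le norm_ge_zero)
        then show "p + t *\<^sub>R (q - p) \<in> cball p d"
          by (auto simp: dist_norm norm_minus_commute)
      next
        fix x assume x: "x \<in> cball p d"
        show "(f has_derivative frechet_derivative f (at x)) (at x within cball p d)"
          using x sub derR by blast
        have xR: "x \<in> R" "p \<in> R" using x sub d by auto
        then have "frechet_derivative f (at x) - frechet_derivative f (at p) = blinfun_apply (F x - F p)"
          using R(2) F[of x] F[of p] by (force simp: fun_eq_iff blinfun.diff_left)
        then have "onorm (frechet_derivative f (at x) - frechet_derivative f (at p)) = norm (F x - F p)"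
          by (metis norm_blinfun.rep_eq)
        also have "\<dots> \<le> e" using d0(2)[OF xR(2) xR(1)] x d by (auto simp: dist_norm norm_minus_commute)
        finally show "onorm (frechet_derivative f (at x) - frechet_derivative f (at p)) \<le> e" .
      qed (use d in auto)
      then show ?thesis by (simp add: mult.commute)
    qed
    then show "\<exists>d>0. \<forall>p\<in>Q. \<forall>q\<in>Q. norm (q - p) \<le> d \<longrightarrow>
        norm (f q - f p - frechet_derivative f (at p) (q - p)) \<le> e * norm (q - p)"
      using d by blast
  qed
qed

section \<open>Differentiability of the flow\<close>

lemma gronwall_linear:
  fixes g :: "real \<Rightarrow> 'a::real_inner"
  assumes "\<And>s. s \<in> {a..b} \<Longrightarrow> (g has_vector_derivative g' s) (at s within {a..b})"
    and "\<And>s. s \<in> {a..b} \<Longrightarrow> norm (g' s) \<le> L * norm (g s)" and "0 \<le> L" and "t \<in> {a..b}"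
  shows "norm (g t) \<le> exp ((L + 1) * (b - a)) * norm (g a)"
  using gronwall_norm[of a b g g' L 0 t] assms by simp

section \<open>The variational equation along a family of solutions\<close>

text \<open>Solutions are assumed, not constructed, and all stay in one compact set. The phase space
  is left abstract so that the results apply both to the given velocity and to the augmented system
  for its derivative.\<close>

locale C1_flow =
  fixes w :: "'a::euclidean_space \<times> real \<Rightarrow> 'a" and W :: "('a \<times> real) set" and K :: "'a set"
    and a b :: real and U :: "'a set" and X :: "'a \<Rightarrow> real \<Rightarrow> 'a"
  assumes W: "open W" and C1: "Ck_on (Suc 0) W w"
    and K: "compact K" "K \<times> {a..b} \<subseteq> W"
    and U: "open U"
    and X_start: "y \<in> U \<Longrightarrow> X y a = y"
    and X_in: "y \<in> U \<Longrightarrow> t \<in> {a..b} \<Longrightarrow> X y t \<in> K"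
    and X_deriv: "y \<in> U \<Longrightarrow> t \<in> {a..b} \<Longrightarrow>
      (X y has_vector_derivative w (X y t, t)) (at t within {a..b})"
begin

abbreviation linearized :: "'a \<Rightarrow> real \<Rightarrow> 'a \<Rightarrow> 'a" where
  "linearized y t h \<equiv> frechet_derivative w (at (X y t, t)) (h, 0)"

abbreviation DX :: "'a \<Rightarrow> 'a \<Rightarrow> real \<Rightarrow> 'a" where
  "DX y h t \<equiv> frechet_derivative (\<lambda>y. X y t) (at y) h"

lemma linearized_linear:
  assumes "y \<in> U" "t \<in> {a..b}"
  shows "linear (linearized y t)"
proof -
  have "(X y t, t) \<in> W" using X_in[OF assms] K assms by auto
  then have "linear (frechet_derivative w (at (X y t, t)))"
    using Ck_on_has_derivative[OF C1] has_derivative_linear by blast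
  then have "linear (frechet_derivative w (at (X y t, t)) \<circ> (\<lambda>h. (h, 0)))"
    by (intro linear_compose) (auto intro!: linearI)
  then show ?thesis by (simp add: o_def)
qed

text \<open>Gronwall turns the Lipschitz bound for \<open>w\<close> into Lipschitz dependence on the
  initial point, with constant G. Linearizing \<open>w\<close> with tolerance e / G then gives an
  error measured by the initial displacement, uniformly in time.\<close>

lemma flow_estimates:
  obtains L where "0 \<le> L"
    "\<And>y t h. y \<in> U \<Longrightarrow> t \<in> {a..b} \<Longrightarrow> norm (linearized y t h) \<le> L * norm h"
    "\<And>y z t. y \<in> U \<Longrightarrow> z \<in> U \<Longrightarrow> t \<in> {a..b} \<Longrightarrow>
       norm (X z t - X y t) \<le> exp ((L + 1) * (b - a)) * norm (z - y)"
    "\<And>y e. y \<in> U \<Longrightarrow> 0 < e \<Longrightarrow> \<exists>d>0. \<forall>z. norm (z - y) \<le> d \<longrightarrow> z \<in> U \<and> (\<forall>t\<in>{a..b}.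
       norm (w (X z t, t) - w (X y t, t) - linearized y t (X z t - X y t)) \<le> e * norm (z - y))"
proof -
  obtain L where L: "0 \<le> L"
    "\<And>p q. p \<in> K \<times> {a..b} \<Longrightarrow> q \<in> K \<times> {a..b} \<Longrightarrow> norm (w q - w p) \<le> L * norm (q - p)"
    "\<And>p h. p \<in> K \<times> {a..b} \<Longrightarrow> norm (frechet_derivative w (at p) h) \<le> L * norm h"
    "\<And>e. 0 < e \<Longrightarrow> \<exists>d>0. \<forall>p\<in>K \<times> {a..b}. \<forall>q\<in>K \<times> {a..b}. norm (q - p) \<le> d \<longrightarrow>
        norm (w q - w p - frechet_derivative w (at p) (q - p)) \<le> e * norm (q - p)"
    using C1_compact_bounds[OF C1 W compact_Times[OF K(1) compact_Icc] K(2)] by blast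
  define G where "G = exp ((L + 1) * (b - a))"
  have G: "0 < G" by (simp add: G_def)
  have mem: "(X y t, t) \<in> K \<times> {a..b}" if "y \<in> U" "t \<in> {a..b}" for y t
    using X_in[OF that] that by simp
  have lip: "norm (X z t - X y t) \<le> G * norm (z - y)" if "y \<in> U" "z \<in> U" "t \<in> {a..b}" for y z t
  proof -
    have "norm (X z t - X y t) \<le> G * norm (X z a - X y a)"
      unfolding G_def
    proof (rule gronwall_linear[where g = "\<lambda>t. X z t - X y t"
          and g' = "\<lambda>t. w (X z t, t) - w (X y t, t)"])
      fix s assume s: "s \<in> {a..b}"
      show "((\<lambda>t. X z t - X y t) has_vector_derivative w (X z s, s) - w (X y s, s)) (at s within {a..b})"
        by (intro has_vector_derivative_diff X_deriv that s)
      show "norm (w (X z s, s) - w (X y s, s)) \<le> L * norm (X z s - X y s)"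
        using L(2)[OF mem[OF that(1) s] mem[OF that(2) s]] by simp
    qed (use L that in auto)
    then show ?thesis using X_start that by simp
  qed
  show thesis
  proof (rule that[OF L(1)])
    show "norm (linearized y t h) \<le> L * norm h" if "y \<in> U" "t \<in> {a..b}" for y t h
      using L(3)[OF mem[OF that], of "(h, 0)"] by simp
    show "norm (X z t - X y t) \<le> exp ((L + 1) * (b - a)) * norm (z - y)"
      if "y \<in> U" "z \<in> U" "t \<in> {a..b}" for y z t
      using lip[OF that] by (simp add: G_def)
    fix y and e :: real assume y: "y \<in> U" and e: "0 < e"
    obtain d0 where d0: "d0 > 0" "\<forall>p\<in>K \<times> {a..b}. \<forall>q\<in>K \<times> {a..b}. norm (q - p) \<le> d0 \<longrightarrow>
        norm (w q - w p - frechet_derivative w (at p) (q - p)) \<le> e / G * norm (q - p)"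
      using L(4)[of "e / G"] e G by auto
    obtain r where r: "r > 0" "cball y r \<subseteq> U" using U y open_contains_cball by blast
    define d where "d = min r (d0 / G)"
    have "norm (w (X z t, t) - w (X y t, t) - linearized y t (X z t - X y t)) \<le> e * norm (z - y)"
      if z: "norm (z - y) \<le> d" and t: "t \<in> {a..b}" for z t
    proof -
      have zU: "z \<in> U" using z r by (auto simp: d_def dist_norm norm_minus_commute)
      have l: "norm (X z t - X y t) \<le> G * norm (z - y)" using lip y zU t by blast
      also have "\<dots> \<le> G * (d0 / G)" using z G by (intro mult_left_mono) (auto simp: d_def)
      finally have "norm (X z t - X y t) \<le> d0" using G by simp
      then have "norm (w (X z t, t) - w (X y t, t) - linearized y t (X z t - X y t))
          \<le> e / G * norm (X z t - X y t)"
        using bspec[OF bspec[OF d0(2) mem[OF y t]] mem[OF zU t]] by simp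
      also have "\<dots> \<le> e / G * (G * norm (z - y))"
        using l e G by (intro mult_left_mono) auto
      finally show ?thesis using G by simp
    qed
    moreover have "z \<in> U" if "norm (z - y) \<le> d" for z
      using that r by (auto simp: d_def dist_norm norm_minus_commute)
    moreover have "d > 0" using r d0 G by (simp add: d_def)
    ultimately show "\<exists>d>0. \<forall>z. norm (z - y) \<le> d \<longrightarrow> z \<in> U \<and> (\<forall>t\<in>{a..b}.
       norm (w (X z t, t) - w (X y t, t) - linearized y t (X z t - X y t)) \<le> e * norm (z - y))"
      by blast
  qed
qed

text \<open>Any two difference quotients in the direction \<open>h\<close> solve the linearized equation up to a small
  error and have the same initial value, so by Gronwall they are close. This yields a solution of the
  linearized equation without an existence theorem for linear systems.\<close>

lemma difference_quotients:
  assumes y: "y \<in> U"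
  obtains Z where "\<And>h. Z h a = h"
    "\<And>h t. t \<in> {a..b} \<Longrightarrow> (Z h has_vector_derivative linearized y t (Z h t)) (at t within {a..b})"
    "\<And>e. 0 < e \<Longrightarrow> \<exists>d>0. \<forall>h t. norm h \<le> d \<longrightarrow> t \<in> {a..b} \<longrightarrow>
       norm (X (y + h) t - X y t - Z h t) \<le> e * norm h"
proof (cases "a \<le> b")
  case False
  then show ?thesis by (intro that[of "\<lambda>h t. h"]) (auto intro: exI[of _ 1])
next
  case ab: True
  obtain L where L: "0 \<le> L" "\<And>t h. t \<in> {a..b} \<Longrightarrow> norm (linearized y t h) \<le> L * norm h"
    and err: "\<And>e. 0 < e \<Longrightarrow> \<exists>d>0. \<forall>z. norm (z - y) \<le> d \<longrightarrow> z \<in> U \<and> (\<forall>t\<in>{a..b}.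
       norm (w (X z t, t) - w (X y t, t) - linearized y t (X z t - X y t)) \<le> e * norm (z - y))"
    using flow_estimates y by metis
  define G where "G = exp ((L + 1) * (b - a))"
  have G: "0 < G" by (simp add: G_def)
  have lin: "linear (linearized y t)" if "t \<in> {a..b}" for t
    using linearized_linear[OF y that] .
  define q where "q = (\<lambda>h c t. (X (y + c *\<^sub>R h) t - X y t) /\<^sub>R c)"
  define q' where "q' = (\<lambda>h c t. (w (X (y + c *\<^sub>R h) t, t) - w (X y t, t)) /\<^sub>R c)"
  \<comment> \<open>The quotients solve the linearized equation up to e |h|, with a threshold that
    depends only on the length of \<open>c *\<^sub>R h\<close>. This uniformity in the direction is
    what finally gives a Frechet derivative.\<close>
  have quot: "\<exists>d>0. \<forall>c h. 0 < c \<longrightarrow> norm (c *\<^sub>R h) \<le> d \<longrightarrow> y + c *\<^sub>R h \<in> U \<and>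
      (\<forall>t\<in>{a..b}. norm (q' h c t - linearized y t (q h c t)) \<le> e * norm h)" if e: "e > 0" for e
  proof -
    obtain d where d: "d > 0" "\<forall>z. norm (z - y) \<le> d \<longrightarrow> z \<in> U \<and> (\<forall>t\<in>{a..b}.
       norm (w (X z t, t) - w (X y t, t) - linearized y t (X z t - X y t)) \<le> e * norm (z - y))"
      using err[OF e] by blast
    have "y + c *\<^sub>R h \<in> U \<and> (\<forall>t\<in>{a..b}. norm (q' h c t - linearized y t (q h c t)) \<le> e * norm h)"
      if c: "0 < c" "norm (c *\<^sub>R h) \<le> d" for c h
    proof (intro conjI ballI)
      have z: "y + c *\<^sub>R h \<in> U" "\<forall>t\<in>{a..b}.
          norm (w (X (y + c *\<^sub>R h) t, t) - w (X y t, t) - linearized y t (X (y + c *\<^sub>R h) t - X y t))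
            \<le> e * norm (c *\<^sub>R h)"
        using d(2)[rule_format, of "y + c *\<^sub>R h"] c by auto
      then show "y + c *\<^sub>R h \<in> U" by simp
      fix t assume t: "t \<in> {a..b}"
      have "q' h c t - linearized y t (q h c t) =
          (w (X (y + c *\<^sub>R h) t, t) - w (X y t, t) - linearized y t (X (y + c *\<^sub>R h) t - X y t)) /\<^sub>R c"
        using linear_cmul[OF lin[OF t], of "inverse c" "X (y + c *\<^sub>R h) t - X y t"]
        unfolding q_def q'_def by (simp add: scaleR_diff_right)
      then have "norm (q' h c t - linearized y t (q h c t)) \<le> (e * norm (c *\<^sub>R h)) / c"
        using z(2) t c by (simp add: divide_right_mono divide_inverse_commute)
      then show "norm (q' h c t - linearized y t (q h c t)) \<le> e * norm h" using c by simp
    qed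
    then show ?thesis using d(1) by blast
  qed
  have qd: "(q h c has_vector_derivative q' h c t) (at t within {a..b})"
    if "y + c *\<^sub>R h \<in> U" "t \<in> {a..b}" for h c t
    unfolding q_def q'_def
    by (intro bounded_linear.has_vector_derivative[OF bounded_linear_scaleR_right] has_vector_derivative_diff X_deriv that y)
  have qa: "q h c a = h" if "y + c *\<^sub>R h \<in> U" "c > 0" for h c
    unfolding q_def using X_start[OF that(1)] X_start[OF y] that(2) by simp
  \<comment> \<open>Both quotients start at \<open>h\<close>, so their difference starts at 0. Two
    errors of e / (2G) add up to e / G, which the Gronwall factor G turns into e.\<close>
  have cauchy: "\<exists>d>0. \<forall>h c k t. 0 < c \<longrightarrow> 0 < k \<longrightarrow> norm (c *\<^sub>R h) \<le> d \<longrightarrow> norm (k *\<^sub>R h) \<le> d \<longrightarrow>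
      t \<in> {a..b} \<longrightarrow> norm (q h c t - q h k t) \<le> e * norm h" if e: "e > 0" for e
  proof -
    obtain d where d: "d > 0" "\<And>c h. 0 < c \<Longrightarrow> norm (c *\<^sub>R h) \<le> d \<Longrightarrow> y + c *\<^sub>R h \<in> U \<and>
      (\<forall>t\<in>{a..b}. norm (q' h c t - linearized y t (q h c t)) \<le> e / (2 * G) * norm h)"
      using quot[of "e / (2 * G)"] e G by (metis divide_pos_pos mult_pos_pos zero_less_numeral)
    have "norm (q h c t - q h k t) \<le> e * norm h"
      if c: "0 < c" "0 < k" "norm (c *\<^sub>R h) \<le> d" "norm (k *\<^sub>R h) \<le> d" and t: "t \<in> {a..b}" for h c k t
    proof -
      have cU: "y + c *\<^sub>R h \<in> U" "y + k *\<^sub>R h \<in> U" using d(2) c by auto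
      have "norm (q h c t - q h k t) \<le> G * (norm (q h c a - q h k a) + e / G * norm h)"
        unfolding G_def
      proof (rule gronwall_norm[where g = "\<lambda>t. q h c t - q h k t" and g' = "\<lambda>t. q' h c t - q' h k t"])
        fix s assume s: "s \<in> {a..b}"
        show "((\<lambda>t. q h c t - q h k t) has_vector_derivative q' h c s - q' h k s) (at s within {a..b})"
          by (intro has_vector_derivative_diff qd cU s)
        have "norm (q' h c s - q' h k s) = norm (linearized y s (q h c s - q h k s)
            + (q' h c s - linearized y s (q h c s)) - (q' h k s - linearized y s (q h k s)))"
          using linear_diff[OF lin[OF s]] by simp
        also have "\<dots> \<le> norm (linearized y s (q h c s - q h k s))
            + norm (q' h c s - linearized y s (q h c s)) + norm (q' h k s - linearized y s (q h k s))"
          by (meson norm_triangle_ineq4 norm_triangle_ineq add_right_mono order_trans)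
        also have "\<dots> \<le> L * norm (q h c s - q h k s) + e / (2 * G) * norm h + e / (2 * G) * norm h"
          using d(2) c s L by (intro add_mono) blast+
        finally show "norm (q' h c s - q' h k s) \<le> L * norm (q h c s - q h k s)
            + e / exp ((L + 1) * (b - a)) * norm h"
          using G unfolding G_def[symmetric] by (simp add: field_simps)
      qed (use L G t e in \<open>auto simp: G_def\<close>)
      then show ?thesis using qa c cU G by simp
    qed
    then show ?thesis using d(1) by blast
  qed
  define k where "k = (\<lambda>n. inverse (real (Suc n)))"
  have k: "k n > 0" for n by (simp add: k_def)
  have k0: "\<forall>\<^sub>F n in sequentially. norm (k n *\<^sub>R h) \<le> d" if "d > 0" for h d
  proof -
    have "(\<lambda>n. k n *\<^sub>R h) \<longlonglongrightarrow> 0 *\<^sub>R h"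
      unfolding k_def by (intro tendsto_intros LIMSEQ_inverse_real_of_nat)
    then have "\<forall>\<^sub>F n in sequentially. norm (k n *\<^sub>R h) < d"
      using that by (intro order_tendstoD(2)[OF tendsto_norm]) auto
    then show ?thesis by eventually_elim simp
  qed
  define Z where "Z = (\<lambda>h t. lim (\<lambda>n. q h (k n) t))"
  have Zlim: "(\<lambda>n. q h (k n) t) \<longlonglongrightarrow> Z h t" if t: "t \<in> {a..b}" for h t
  proof -
    have "Cauchy (\<lambda>n. q h (k n) t)"
    proof (rule metric_CauchyI)
      fix e :: real assume e: "e > 0"
      define e' where "e' = e / (2 * (norm h + 1))"
      have e': "e' > 0" using e by (auto simp: e'_def intro!: divide_pos_pos add_nonneg_pos)
      obtain d where d: "d > 0" "\<forall>h c k t. 0 < c \<longrightarrow> 0 < k \<longrightarrow> norm (c *\<^sub>R h) \<le> d \<longrightarrow>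
          norm (k *\<^sub>R h) \<le> d \<longrightarrow> t \<in> {a..b} \<longrightarrow> norm (q h c t - q h k t) \<le> e' * norm h"
        using cauchy[OF e'] by blast
      obtain N where N: "\<And>n. n \<ge> N \<Longrightarrow> norm (k n *\<^sub>R h) \<le> d"
        using k0[OF d(1), of h] unfolding eventually_sequentially by blast
      have "norm h + 1 > 0" using norm_ge_zero[of h] by linarith
      then have "e = e' * (2 * (norm h + 1))" by (simp add: e'_def)
      moreover have "e' * norm h < e' * (2 * (norm h + 1))"
      proof (rule mult_strict_left_mono[OF _ e'])
        show "norm h < 2 * (norm h + 1)" using \<open>norm h + 1 > 0\<close> by (simp add: algebra_simps)
      qed
      ultimately have "e' * norm h < e" by simp
      then have "dist (q h (k m) t) (q h (k n) t) < e" if "m \<ge> N" "n \<ge> N" for m n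
        using d(2)[rule_format, OF k k N[OF that(1)] N[OF that(2)] t] by (simp add: dist_norm)
      then show "\<exists>M. \<forall>m\<ge>M. \<forall>n\<ge>M. dist (q h (k m) t) (q h (k n) t) < e" by blast
    qed
    then show ?thesis
      unfolding Z_def by (simp add: Cauchy_convergent_iff convergent_LIMSEQ_iff)
  qed
  \<comment> \<open>Letting the second step size tend to 0 in \<open>cauchy\<close> preserves the
    uniformity in \<open>h\<close> and \<open>t\<close>.\<close>
  have qZ: "\<exists>d>0. \<forall>h c t. 0 < c \<longrightarrow> norm (c *\<^sub>R h) \<le> d \<longrightarrow> t \<in> {a..b} \<longrightarrow>
      norm (q h c t - Z h t) \<le> e * norm h" if e: "e > 0" for e
  proof -
    obtain d where d: "d > 0" "\<forall>h c k t. 0 < c \<longrightarrow> 0 < k \<longrightarrow> norm (c *\<^sub>R h) \<le> d \<longrightarrow>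
          norm (k *\<^sub>R h) \<le> d \<longrightarrow> t \<in> {a..b} \<longrightarrow> norm (q h c t - q h k t) \<le> e * norm h"
      using cauchy[OF e] by blast
    have "norm (q h c t - Z h t) \<le> e * norm h"
      if c: "0 < c" "norm (c *\<^sub>R h) \<le> d" and t: "t \<in> {a..b}" for h c t
    proof (rule tendsto_upperbound)
      show "(\<lambda>n. norm (q h c t - q h (k n) t)) \<longlonglongrightarrow> norm (q h c t - Z h t)"
        by (intro tendsto_intros Zlim t)
      show "\<forall>\<^sub>F n in sequentially. norm (q h c t - q h (k n) t) \<le> e * norm h"
        using k0[OF d(1), of h] by eventually_elim (use d(2) c t k in blast)
    qed simp
    then show ?thesis using d(1) by blast
  qed
  show ?thesis
  proof (rule that[of Z])
    show "Z h a = h" for h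
    proof -
      obtain d where d: "d > 0" "\<And>c h. 0 < c \<Longrightarrow> norm (c *\<^sub>R h) \<le> d \<Longrightarrow> y + c *\<^sub>R h \<in> U"
        using quot[of 1] by (metis zero_less_one)
      have "\<forall>\<^sub>F n in sequentially. q h (k n) a = h"
        using k0[OF d(1), of h] by eventually_elim (use qa d(2) k in blast)
      then have "(\<lambda>n. q h (k n) a) \<longlonglongrightarrow> h" by (rule tendsto_eventually)
      then show ?thesis using Zlim[of a h] ab LIMSEQ_unique by auto
    qed
  next
    fix h :: 'a and t assume t: "t \<in> {a..b}"
    obtain d0 where d0: "d0 > 0" "\<And>c h. 0 < c \<Longrightarrow> norm (c *\<^sub>R h) \<le> d0 \<Longrightarrow> y + c *\<^sub>R h \<in> U"
      using quot[of 1] by (metis zero_less_one)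
    obtain N where N: "\<And>n. n \<ge> N \<Longrightarrow> norm (k n *\<^sub>R h) \<le> d0"
      using k0[OF d0(1), of h] unfolding eventually_sequentially by blast
    \<comment> \<open>Differentiation of the limit in time: the derivatives of the quotients
      converge uniformly to the linearized field along \<open>Z\<close>. The shift by
      \<open>N\<close> keeps every initial point inside \<open>U\<close>.\<close>
    have "\<exists>g. \<forall>x\<in>{a..b}. (\<lambda>n. q h (k (n + N)) x) \<longlonglongrightarrow> g x \<and>
        (g has_derivative (\<lambda>s. s *\<^sub>R linearized y x (Z h x))) (at x within {a..b})"
    proof (rule has_derivative_sequence[where ?x0.0 = a and l = "Z h a" and S = "{a..b}"
          and f = "\<lambda>n. q h (k (n + N))" and f' = "\<lambda>n x s. s *\<^sub>R q' h (k (n + N)) x"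
          and g' = "\<lambda>x s. s *\<^sub>R linearized y x (Z h x)"])
      show "(q h (k (n + N)) has_derivative (\<lambda>s. s *\<^sub>R q' h (k (n + N)) x)) (at x within {a..b})"
        if "x \<in> {a..b}" for n x
        using qd[OF d0(2)[OF k N] that, of "n + N"] by (simp add: has_vector_derivative_def)
      show "(\<lambda>n. q h (k (n + N)) a) \<longlonglongrightarrow> Z h a"
        using Zlim[of a h] ab by (intro LIMSEQ_ignore_initial_segment) auto
      fix e :: real assume e: "e > 0"
      define e' where "e' = e / ((L + 1) * (norm h + 1))"
      have e': "e' > 0" using e L by (auto simp: e'_def intro!: divide_pos_pos add_nonneg_pos mult_pos_pos)
      obtain d1 where d1: "d1 > 0" "\<forall>c h. 0 < c \<longrightarrow> norm (c *\<^sub>R h) \<le> d1 \<longrightarrow> y + c *\<^sub>R h \<in> U \<and>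
          (\<forall>t\<in>{a..b}. norm (q' h c t - linearized y t (q h c t)) \<le> e' * norm h)"
        using quot[OF e'] by blast
      obtain d2 where d2: "d2 > 0" "\<forall>h c t. 0 < c \<longrightarrow> norm (c *\<^sub>R h) \<le> d2 \<longrightarrow> t \<in> {a..b} \<longrightarrow>
          norm (q h c t - Z h t) \<le> e' * norm h"
        using qZ[OF e'] by blast
      have *: "norm (s *\<^sub>R q' h (k n) x - s *\<^sub>R linearized y x (Z h x)) \<le> e * norm s"
        if "norm (k n *\<^sub>R h) \<le> d1" "norm (k n *\<^sub>R h) \<le> d2" and x: "x \<in> {a..b}" for n x s
      proof -
        have "norm (q' h (k n) x - linearized y x (Z h x)) = norm (
            (q' h (k n) x - linearized y x (q h (k n) x)) + linearized y x (q h (k n) x - Z h x))"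
          using linear_diff[OF lin[OF x]] by simp
        also have "\<dots> \<le> e' * norm h + L * (e' * norm h)"
        proof (rule order_trans[OF norm_triangle_ineq], rule add_mono)
          show "norm (q' h (k n) x - linearized y x (q h (k n) x)) \<le> e' * norm h"
            using d1(2) that k by blast
          have "norm (linearized y x (q h (k n) x - Z h x)) \<le> L * norm (q h (k n) x - Z h x)"
            using L(2) x by blast
          also have "\<dots> \<le> L * (e' * norm h)"
            using d2(2)[rule_format, OF k that(2) x] L(1) by (rule mult_left_mono)
          finally show "norm (linearized y x (q h (k n) x - Z h x)) \<le> L * (e' * norm h)" .
        qed
        also have "\<dots> = e' * (L + 1) * norm h" by (simp add: algebra_simps)
        also have "\<dots> \<le> e' * (L + 1) * (norm h + 1)" using e' L by (intro mult_left_mono) auto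
        also have "\<dots> = e"
        proof -
          have "(L + 1) * (norm h + 1) \<noteq> 0" using L(1) norm_ge_zero[of h] by (smt (verit) no_zero_divisors)
          then show ?thesis by (simp add: e'_def)
        qed
        finally have "norm (q' h (k n) x - linearized y x (Z h x)) \<le> e" .
        then have "norm s * norm (q' h (k n) x - linearized y x (Z h x)) \<le> norm s * e"
          by (intro mult_left_mono) auto
        then show ?thesis by (simp add: mult.commute flip: scaleR_diff_right)
      qed
      have "\<forall>\<^sub>F n in sequentially. \<forall>x\<in>{a..b}. \<forall>s.
          norm (s *\<^sub>R q' h (k n) x - s *\<^sub>R linearized y x (Z h x)) \<le> e * norm s"
        using k0[OF d1(1), of h] k0[OF d2(1), of h] by eventually_elim (use * in blast)
      then show "\<forall>\<^sub>F n in sequentially. \<forall>x\<in>{a..b}. \<forall>s.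
          norm (s *\<^sub>R q' h (k (n + N)) x - s *\<^sub>R linearized y x (Z h x)) \<le> e * norm s"
        by (rule sequentially_offset)
    qed (use ab in auto)
    then obtain g where g: "\<And>x. x \<in> {a..b} \<Longrightarrow> (\<lambda>n. q h (k (n + N)) x) \<longlonglongrightarrow> g x"
      "\<And>x. x \<in> {a..b} \<Longrightarrow> (g has_vector_derivative linearized y x (Z h x)) (at x within {a..b})"
      unfolding has_vector_derivative_def by blast
    have "g x = Z h x" if "x \<in> {a..b}" for x
      using g(1)[OF that] LIMSEQ_ignore_initial_segment[OF Zlim[OF that, of h], of N] LIMSEQ_unique by blast
    then show "(Z h has_vector_derivative linearized y t (Z h t)) (at t within {a..b})"
      by (intro has_vector_derivative_transform[OF t _ g(2)[OF t]]) simp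
  next
    fix e :: real assume "0 < e"
    then obtain d where d: "d > 0" "\<forall>h c t. 0 < c \<longrightarrow> norm (c *\<^sub>R h) \<le> d \<longrightarrow> t \<in> {a..b} \<longrightarrow>
          norm (q h c t - Z h t) \<le> e * norm h"
      using qZ by blast
    \<comment> \<open>The step size 1 is admissible, because smallness is required only of the
      product of step size and direction.\<close>
    have "norm (X (y + h) t - X y t - Z h t) \<le> e * norm h" if "norm h \<le> d" "t \<in> {a..b}" for h t
      using d(2)[rule_format, of 1 h t] that by (simp add: q_def)
    then show "\<exists>d>0. \<forall>h t. norm h \<le> d \<longrightarrow> t \<in> {a..b} \<longrightarrow>
       norm (X (y + h) t - X y t - Z h t) \<le> e * norm h"
      using d(1) by blast
  qed
qed

text \<open>The limit of the difference quotients is linear in \<open>h\<close>: the defect of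
  additivity or homogeneity solves the linearized equation with initial value 0 and so vanishes by
  Gronwall. Hence it is the derivative, and it satisfies the variational equation. The uniform bound
  later provides the compact set for the augmented system.\<close>

lemma flow_differentiable:
  obtains G where "0 \<le> G"
    "\<And>y t. y \<in> U \<Longrightarrow> t \<in> {a..b} \<Longrightarrow> ((\<lambda>y. X y t) has_derivative (\<lambda>h. DX y h t)) (at y)"
    "\<And>y h. y \<in> U \<Longrightarrow> a \<le> b \<Longrightarrow> DX y h a = h"
    "\<And>y h t. y \<in> U \<Longrightarrow> t \<in> {a..b} \<Longrightarrow>
      (DX y h has_vector_derivative linearized y t (DX y h t)) (at t within {a..b})"
    "\<And>y h t. y \<in> U \<Longrightarrow> t \<in> {a..b} \<Longrightarrow> norm (DX y h t) \<le> G * norm h"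
proof -
  obtain L where L: "0 \<le> L" "\<And>y t h. y \<in> U \<Longrightarrow> t \<in> {a..b} \<Longrightarrow> norm (linearized y t h) \<le> L * norm h"
    using flow_estimates by metis
  define G where "G = exp ((L + 1) * (b - a))"
  have main: "((\<lambda>y. X y t) has_derivative (\<lambda>h. DX y h t)) (at y) \<and> DX y h a = h \<and>
      (DX y h has_vector_derivative linearized y t (DX y h t)) (at t within {a..b}) \<and>
      norm (DX y h t) \<le> G * norm h" if y: "y \<in> U" and t: "t \<in> {a..b}" for y h t
  proof -
    obtain Z where Z: "\<And>h. Z h a = h"
      "\<And>h t. t \<in> {a..b} \<Longrightarrow> (Z h has_vector_derivative linearized y t (Z h t)) (at t within {a..b})"
      "\<And>e. 0 < e \<Longrightarrow> \<exists>d>0. \<forall>h t. norm h \<le> d \<longrightarrow> t \<in> {a..b} \<longrightarrow>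
         norm (X (y + h) t - X y t - Z h t) \<le> e * norm h"
      using difference_quotients[OF y] by blast
    have lin: "linear (linearized y t)" if "t \<in> {a..b}" for t
      using linearized_linear[OF y that] .
    have bound: "norm (g t) \<le> G * norm (g a)"
      if "\<And>t. t \<in> {a..b} \<Longrightarrow> (g has_vector_derivative linearized y t (g t)) (at t within {a..b})"
        "t \<in> {a..b}" for g t
      unfolding G_def using that L y
      by (intro gronwall_linear[where g = g and g' = "\<lambda>t. linearized y t (g t)"]) auto
    have Zder: "((\<lambda>y. X y t) has_derivative (\<lambda>h. Z h t)) (at y)" if t: "t \<in> {a..b}" for t
      unfolding has_derivative_at_alt
    proof (intro conjI allI impI)
      have "linear (\<lambda>h. Z h t)"
      proof (rule linearI)
        fix h k
        have "norm (Z (h + k) t - (Z h t + Z k t)) \<le> G * norm (Z (h + k) a - (Z h a + Z k a))"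
        proof (rule bound[of "\<lambda>t. Z (h + k) t - (Z h t + Z k t)", OF _ t])
          fix s assume s: "s \<in> {a..b}"
          show "((\<lambda>t. Z (h + k) t - (Z h t + Z k t)) has_vector_derivative
              linearized y s (Z (h + k) s - (Z h s + Z k s))) (at s within {a..b})"
            unfolding linear_diff[OF lin[OF s]] linear_add[OF lin[OF s]]
            by (intro has_vector_derivative_diff has_vector_derivative_add Z(2) s)
        qed
        then show "Z (h + k) t = Z h t + Z k t" by (simp add: Z(1))
      next
        fix c h
        have "norm (Z (c *\<^sub>R h) t - c *\<^sub>R Z h t) \<le> G * norm (Z (c *\<^sub>R h) a - c *\<^sub>R Z h a)"
        proof (rule bound[of "\<lambda>t. Z (c *\<^sub>R h) t - c *\<^sub>R Z h t", OF _ t])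
          fix s assume s: "s \<in> {a..b}"
          show "((\<lambda>t. Z (c *\<^sub>R h) t - c *\<^sub>R Z h t) has_vector_derivative
              linearized y s (Z (c *\<^sub>R h) s - c *\<^sub>R Z h s)) (at s within {a..b})"
            unfolding linear_diff[OF lin[OF s]] linear_cmul[OF lin[OF s]]
            by (intro has_vector_derivative_diff bounded_linear.has_vector_derivative[OF bounded_linear_scaleR_right] Z(2) s)
        qed
        then show "Z (c *\<^sub>R h) t = c *\<^sub>R Z h t" by (simp add: Z(1))
      qed
      then show "bounded_linear (\<lambda>h. Z h t)" by (simp add: linear_conv_bounded_linear)
      fix e :: real assume "0 < e"
      then obtain d where "d > 0" "\<forall>h t. norm h \<le> d \<longrightarrow> t \<in> {a..b} \<longrightarrow>
         norm (X (y + h) t - X y t - Z h t) \<le> e * norm h"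
        using Z(3) by blast
      then have "d > 0 \<and> (\<forall>z. norm (z - y) < d \<longrightarrow> norm (X z t - X y t - Z (z - y) t) \<le> e * norm (z - y))"
        using t by (metis add.commute diff_add_cancel less_imp_le)
      then show "\<exists>d>0. \<forall>z. norm (z - y) < d \<longrightarrow> norm (X z t - X y t - Z (z - y) t) \<le> e * norm (z - y)"
        by blast
    qed
    have eq: "DX y h t = Z h t" if "t \<in> {a..b}" for h t
      using frechet_derivative_at[OF Zder[OF that]] by (rule fun_cong[THEN sym])
    have "(DX y h has_vector_derivative linearized y t (Z h t)) (at t within {a..b})"
      by (rule has_vector_derivative_transform[OF t _ Z(2)[OF t, of h]]) (simp add: eq)
    moreover have "norm (Z h t) \<le> G * norm h"
      using bound[of "Z h", OF Z(2) t] by (simp add: Z(1))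
    moreover have "DX y h a = h" using eq[of a h] Z(1) t by simp
    ultimately show ?thesis using Zder[OF t] eq[OF t] by simp
  qed
  show ?thesis
    by (rule that[of G]) (use main in \<open>auto simp: G_def\<close>)
qed

lemma DX_has_derivative:
  assumes "y \<in> U" "t \<in> {a..b}"
  shows "((\<lambda>y. X y t) has_derivative (\<lambda>h. DX y h t)) (at y)"
  by (rule flow_differentiable) (use assms in blast)

end

text \<open>The derivative of the flow is itself a component of the flow of the augmented system
  \<open>x' = w (x, t)\<close>, \<open>z' = D\<^sub>x w (x, t) z\<close>, so it is differentiable by the same theorem.\<close>

lemma (in C1_flow) DX_differentiable:
  assumes C2: "Ck_on (Suc (Suc 0)) W w" and y: "y \<in> U" and t: "t \<in> {a..b}"
  shows "(\<lambda>y. DX y h t) differentiable (at y)"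
proof -
  obtain G where G: "0 \<le> G"
    and "\<And>y t. y \<in> U \<Longrightarrow> t \<in> {a..b} \<Longrightarrow> ((\<lambda>y. X y t) has_derivative (\<lambda>h. DX y h t)) (at y)"
    and DX_start: "\<And>y h. y \<in> U \<Longrightarrow> a \<le> b \<Longrightarrow> DX y h a = h"
    and DX_deriv: "\<And>y h t. y \<in> U \<Longrightarrow> t \<in> {a..b} \<Longrightarrow>
      (DX y h has_vector_derivative linearized y t (DX y h t)) (at t within {a..b})"
    and DX_bound: "\<And>y h t. y \<in> U \<Longrightarrow> t \<in> {a..b} \<Longrightarrow> norm (DX y h t) \<le> G * norm h"
    by (rule flow_differentiable) (rule that)
  define pr :: "('a \<times> 'a) \<times> real \<Rightarrow> 'a \<times> real" where "pr = (\<lambda>q. (fst (fst q), snd q))"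
  define D where "D = (\<lambda>i p. frechet_derivative w (at p) (i::'a, 0::real))"
  \<comment> \<open>The second component is D_x w applied to z, written over a basis so that z
    enters only through scalar coefficients; each directional derivative \<open>D i\<close> is C^1
    by \<open>C2\<close>.\<close>
  define w2 where "w2 = (\<lambda>q. (w (pr q), \<Sum>i\<in>Basis. (snd (fst q) \<bullet> i) *\<^sub>R D i (pr q)))"
  \<comment> \<open>Initial vectors range over an open ball containing \<open>h\<close>; by
    \<open>DX_bound\<close> their orbits remain in the compact ball of radius G r.\<close>
  define r where "r = norm h + 1"
  have w2_eq: "w2 ((x, z), s) = (w (x, s), frechet_derivative w (at (x, s)) (z, 0))"
    if "(x, s) \<in> W" for x z s
  proof -
    have "linear (frechet_derivative w (at (x, s)))"
      using Ck_on_has_derivative[OF C1 that] has_derivative_linear by blast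
    then have lin: "linear (\<lambda>z. frechet_derivative w (at (x, s)) (z, 0))"
      using linear_compose[of "\<lambda>h. (h, 0)" "frechet_derivative w (at (x, s))"]
      by (simp add: o_def linear_iff)
    have "frechet_derivative w (at (x, s)) (\<Sum>i\<in>Basis. (z \<bullet> i) *\<^sub>R i, 0)
        = (\<Sum>i\<in>Basis. (z \<bullet> i) *\<^sub>R frechet_derivative w (at (x, s)) (i, 0))"
      using linear_sum[OF lin, of "\<lambda>i. (z \<bullet> i) *\<^sub>R i" Basis] linear_cmul[OF lin] by simp
    then show ?thesis by (simp add: w2_def pr_def D_def euclidean_representation)
  qed
  have cpr: "continuous_on S pr" for S unfolding pr_def by (intro continuous_intros)
  have openW2: "open (pr -` W)" by (rule open_vimage[OF W cpr])
  have dpr: "(pr has_derivative pr) (at q)" for q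
    unfolding pr_def by (auto intro!: derivative_eq_intros)
  have dw: "(w has_derivative frechet_derivative w (at p)) (at p)" if "p \<in> W" for p
    using C1 that by (rule Ck_on_has_derivative)
  have C1D: "Ck_on (Suc 0) W (D i)" for i
    unfolding D_def using C2 by simp
  have dD: "(D i has_derivative frechet_derivative (D i) (at p)) (at p)" if "p \<in> W" for p i
    using C1D that by (rule Ck_on_has_derivative)
  have C1w2: "Ck_on (Suc 0) (pr -` W) w2"
  proof (rule C1_onI[OF openW2])
    fix q assume "q \<in> pr -` W"
    then have q: "pr q \<in> W" by simp
    note 1 = has_derivative_compose[OF dpr dw[OF q]]
    note 2 = has_derivative_compose[OF dpr dD[OF q]]
    show "(w2 has_derivative (\<lambda>k. (frechet_derivative w (at (pr q)) (pr k),
        \<Sum>i\<in>Basis. (snd (fst q) \<bullet> i) *\<^sub>R frechet_derivative (D i) (at (pr q)) (pr k)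
           + (snd (fst k) \<bullet> i) *\<^sub>R D i (pr q)))) (at q)"
      unfolding w2_def
      by (intro has_derivative_Pair 1 has_derivative_sum has_derivative_scaleR 2 has_derivative_inner_left
          has_derivative_snd has_derivative_fst has_derivative_ident)
  next
    fix k
    have cont: "continuous_on (pr -` W) (\<lambda>q. g (pr q))" if "continuous_on W g" for g :: "_ \<Rightarrow> 'a"
      by (rule continuous_on_compose2[OF that cpr]) auto
    have "continuous_on (pr -` W) (\<lambda>q. frechet_derivative w (at (pr q)) (pr k))"
      using C1[unfolded Ck_on.simps, THEN conjunct2, rule_format] by (rule cont)
    moreover have "continuous_on (pr -` W) (\<lambda>q. frechet_derivative (D i) (at (pr q)) (pr k))" for i
      using C1D[of i, unfolded Ck_on.simps, THEN conjunct2, rule_format] by (rule cont)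
    moreover have "continuous_on (pr -` W) (\<lambda>q. D i (pr q))" for i
      using Ck_on_imp_continuous_on[OF C1D[of i]] by (intro cont)
    ultimately show "continuous_on (pr -` W) (\<lambda>q. (frechet_derivative w (at (pr q)) (pr k),
        \<Sum>i\<in>Basis. (snd (fst q) \<bullet> i) *\<^sub>R frechet_derivative (D i) (at (pr q)) (pr k)
           + (snd (fst k) \<bullet> i) *\<^sub>R D i (pr q)))"
      by (intro continuous_on_Pair continuous_on_sum continuous_on_add continuous_on_scaleR
          continuous_on_inner continuous_on_snd continuous_on_fst continuous_on_id continuous_on_const)
  qed
  interpret aug: C1_flow w2 "pr -` W" "K \<times> cball 0 (G * r)" a b "U \<times> ball 0 r"
    "\<lambda>p t. (X (fst p) t, DX (fst p) (snd p) t)"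
  proof
    show "open (pr -` W)" by (rule openW2)
    show "Ck_on (Suc 0) (pr -` W) w2" by (rule C1w2)
    show "compact (K \<times> cball (0::'a) (G * r))" using K by (intro compact_Times) auto
    show "(K \<times> cball (0::'a) (G * r)) \<times> {a..b} \<subseteq> pr -` W" using K by (auto simp: pr_def)
    show "open (U \<times> ball (0::'a) r)" using U by (intro open_Times) auto
  next
    fix p :: "'a \<times> 'a" assume "p \<in> U \<times> ball 0 r"
    then show "(X (fst p) a, DX (fst p) (snd p) a) = p"
      using t by (auto simp: X_start DX_start)
  next
    fix p :: "'a \<times> 'a" and s assume p: "p \<in> U \<times> ball 0 r" and s: "s \<in> {a..b}"
    have "norm (DX (fst p) (snd p) s) \<le> G * norm (snd p)" using p s by (intro DX_bound) auto
    also have "\<dots> \<le> G * r" using p G by (intro mult_left_mono) auto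
    finally show "(X (fst p) s, DX (fst p) (snd p) s) \<in> K \<times> cball 0 (G * r)"
      using p s X_in by auto
    have pU: "fst p \<in> U" using p by auto
    have "(X (fst p) s, s) \<in> W" using X_in[OF pU s] s K by auto
    from w2_eq[OF this]
    show "((\<lambda>t. (X (fst p) t, DX (fst p) (snd p) t)) has_vector_derivative
        w2 ((X (fst p) s, DX (fst p) (snd p) s), s)) (at s within {a..b})"
      by (simp add: has_vector_derivative_Pair X_deriv[OF pU s] DX_deriv[OF pU s])
  qed
  \<comment> \<open>Joint differentiability in the point and the vector; composing with y \<mapsto>
    (y, h) freezes the vector.\<close>
  have "(\<lambda>p. (X (fst p) t, DX (fst p) (snd p) t)) differentiable (at (y, h))"
    using aug.DX_has_derivative[of "(y, h)" t] y t
    by (auto intro: differentiableI simp: r_def)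
  from differentiable_compose[OF bounded_linear_imp_differentiable[OF bounded_linear_snd] this]
  have "(\<lambda>p. DX (fst p) (snd p) t) differentiable (at (y, h))"
    by simp
  moreover have "(\<lambda>y. (y, h)) differentiable (at y)"
    unfolding differentiable_def by (rule exI, rule has_derivative_Pair[OF has_derivative_ident has_derivative_const])
  ultimately show ?thesis
    using differentiable_compose[of "\<lambda>p. DX (fst p) (snd p) t" "\<lambda>y. (y, h)" y] by simp
qed

section \<open>Regularity of the flow map and its gradient\<close>

text \<open>This is what gives the definite description in \<open>flow_map\<close> a value at every
  time of the interval.\<close>

lemma trajectory_unique:
  assumes D: "compact D" and v: "smooth_velocity D v t0 T"
    and x: "trajectory D v t0 T x" and z: "trajectory D v t0 T z" and "x t0 = z t0"
    and t: "t \<in> {t0..t0 + T}"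
  shows "x t = z t"
proof -
  obtain W w where W: "open W" "D \<times> {t0..t0 + T} \<subseteq> W" "smooth_on W w"
    and w: "\<And>x t. x \<in> D \<Longrightarrow> t \<in> {t0..t0 + T} \<Longrightarrow> v x t = w (x, t)"
    using v unfolding smooth_velocity_def by blast
  have "Ck_on (Suc 0) W w" using W(3) unfolding smooth_on_def by blast
  then obtain L where L: "0 \<le> L"
    "\<And>p q. p \<in> D \<times> {t0..t0 + T} \<Longrightarrow> q \<in> D \<times> {t0..t0 + T} \<Longrightarrow> norm (w q - w p) \<le> L * norm (q - p)"
    using C1_compact_bounds[OF _ W(1) compact_Times[OF D compact_Icc] W(2)] by metis
  have "norm (x t - z t) \<le> exp ((L + 1) * (t0 + T - t0)) * norm (x t0 - z t0)"
  proof (rule gronwall_linear[where g = "\<lambda>t. x t - z t" and g' = "\<lambda>t. v (x t) t - v (z t) t"])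
    fix s assume s: "s \<in> {t0..t0 + T}"
    show "((\<lambda>t. x t - z t) has_vector_derivative v (x s) s - v (z s) s) (at s within {t0..t0 + T})"
      using x z s unfolding trajectory_def by (intro has_vector_derivative_diff) auto
    have "x s \<in> D" "z s \<in> D" using x z s unfolding trajectory_def by auto
    then show "norm (v (x s) s - v (z s) s) \<le> L * norm (x s - z s)"
      using L(2)[of "(z s, s)" "(x s, s)"] s w by simp
  qed (use L t in auto)
  then show ?thesis using assms(5) by simp
qed

lemma differentiable_cong_open:
  assumes "f differentiable (at x)" "open S" "x \<in> S" "\<And>y. y \<in> S \<Longrightarrow> f y = g y"
  shows "g differentiable (at x)"
proof -
  obtain f' where "(f has_derivative f') (at x)" using assms(1) unfolding differentiable_def by blast
  then have "(g has_derivative f') (at x)"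
    by (rule has_derivative_transform_within_open[OF _ assms(2-4)])
  then show ?thesis unfolding differentiable_def by blast
qed

lemma matrix_differentiableI:
  fixes A :: "'a::real_normed_vector \<Rightarrow> real^'n^'m"
  assumes "\<And>h. (\<lambda>x. A x *v h) differentiable (at x)"
  shows "A differentiable (at x)"
  unfolding differentiable_componentwise_within[of A]
proof
  fix i :: "real^'n^'m" assume "i \<in> Basis"
  then obtain k j where i: "i = axis k (axis j 1)" by (auto simp: Basis_vec_def)
  have "(A y *v axis j 1) \<bullet> axis k 1 = A y \<bullet> i" for y
    by (simp add: i inner_axis matrix_vector_mul_component matrix_vector_mult_basis column_def)
  then show "(\<lambda>y. A y \<bullet> i) differentiable (at x)"
    using differentiable_inner[OF assms[of "axis j 1"] differentiable_const[of "axis k 1"]] by simp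
qed

text \<open>One trajectory is chosen for each interior initial point; uniqueness identifies its
  endpoint with the flow map. The gradient applied to a fixed vector is then \<open>F.DX\<close> at
  the final time, which is differentiable because the velocity is C^2.\<close>

lemma flow_gradient_differentiable:
  assumes D: "compact D" and T: "T > 0" and v: "smooth_velocity D v t0 T"
    and x: "x \<in> interior (flow_domain D v t0 T)"
  shows "flow_gradient D v t0 T differentiable (at x)"
proof -
  obtain W w where W: "open W" "D \<times> {t0..t0 + T} \<subseteq> W" "smooth_on W w"
    and w: "\<And>x t. x \<in> D \<Longrightarrow> t \<in> {t0..t0 + T} \<Longrightarrow> v x t = w (x, t)"
    using v unfolding smooth_velocity_def by blast
  define U where "U = interior (flow_domain D v t0 T)"
  have U: "open U" by (simp add: U_def)
  define X where "X = (\<lambda>y. SOME x. trajectory D v t0 T x \<and> x t0 = y)"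
  have X: "trajectory D v t0 T (X y) \<and> X y t0 = y" if "y \<in> U" for y
  proof -
    have "\<exists>x. trajectory D v t0 T x \<and> x t0 = y"
      using that interior_subset unfolding U_def flow_domain_def by blast
    then show ?thesis unfolding X_def by (rule someI_ex)
  qed
  interpret F: C1_flow w W D t0 "t0 + T" U X
  proof
    show "Ck_on (Suc 0) W w" using W(3) unfolding smooth_on_def by blast
    show "open U" by (rule U)
    fix y assume y: "y \<in> U"
    show "X y t0 = y" using X[OF y] by simp
    fix t assume t: "t \<in> {t0..t0 + T}"
    show "X y t \<in> D" using X[OF y] t unfolding trajectory_def by blast
    then show "(X y has_vector_derivative w (X y t, t)) (at t within {t0..t0 + T})"
      using X[OF y] t w unfolding trajectory_def by metis
  qed (use D W in auto)
  have Tin: "t0 + T \<in> {t0..t0 + T}" using T by simp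
  have flow: "flow_map D v t0 T (t0 + T) y = X y (t0 + T)" if "y \<in> U" for y
    unfolding flow_map_def
  proof (rule the_equality)
    show "\<exists>x. trajectory D v t0 T x \<and> x t0 = y \<and> x (t0 + T) = X y (t0 + T)"
      using X[OF that] by blast
    show "z = X y (t0 + T)" if "\<exists>x. trajectory D v t0 T x \<and> x t0 = y \<and> x (t0 + T) = z" for z
      using that X[OF \<open>y \<in> U\<close>] trajectory_unique[OF D v _ _ _ Tin] by metis
  qed
  have grad: "flow_gradient D v t0 T y *v h = F.DX y h (t0 + T)" if y: "y \<in> U" for y h
  proof -
    have "((\<lambda>y. X y (t0 + T)) has_derivative (\<lambda>h. F.DX y h (t0 + T))) (at y)"
      using F.DX_has_derivative y Tin by blast
    then have "(flow_map D v t0 T (t0 + T) has_derivative (\<lambda>h. F.DX y h (t0 + T))) (at y)"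
      by (rule has_derivative_transform_within_open[OF _ U y]) (simp add: flow)
    moreover from this have "(flow_map D v t0 T (t0 + T) has_derivative
        (\<lambda>h. flow_gradient D v t0 T y *v h)) (at y)"
      unfolding flow_gradient_def using jacobian_works differentiableI by blast
    ultimately show ?thesis by (metis has_derivative_unique)
  qed
  have "Ck_on (Suc (Suc 0)) W w" using W(3) unfolding smooth_on_def by blast
  then have "(\<lambda>y. F.DX y h (t0 + T)) differentiable (at x)" for h
    using F.DX_differentiable x Tin unfolding U_def by blast
  then have "(\<lambda>y. flow_gradient D v t0 T y *v h) differentiable (at x)" for h
    by (rule differentiable_cong_open[OF _ U]) (use x grad in \<open>auto simp: U_def\<close>)
  then show ?thesis by (rule matrix_differentiableI)
qed

section \<open>Helicity of a field normal to a surface\<close>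

text \<open>The mean value inequality is applied to \<tau> \<mapsto> f (x + \<tau> h + s k) - f (x +
  \<tau> h) - \<tau> s B k on [0, s]. Differentiability of the directional derivative at the single
  point \<open>x\<close> controls the derivative of this function.\<close>

lemma second_difference:
  fixes f :: "'a::real_normed_vector \<Rightarrow> 'b::real_normed_vector"
  assumes S: "open S" "x \<in> S" and f: "\<And>y. y \<in> S \<Longrightarrow> f differentiable (at y)"
    and B: "((\<lambda>y. frechet_derivative f (at y) h) has_derivative B) (at x)" and e: "0 < e"
  shows "\<exists>d>0. \<forall>s. 0 < s \<longrightarrow> s < d \<longrightarrow>
    norm (f (x + s *\<^sub>R h + s *\<^sub>R k) - f (x + s *\<^sub>R h) - f (x + s *\<^sub>R k) + f x - (s * s) *\<^sub>R B k) \<le> e * (s * s)"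
proof -
  \<comment> \<open>The two displacements used below have lengths at most s (|h| + |k|) and s |h|,
    which sum to s (c - 1); the final 1 keeps \<open>c\<close> positive.\<close>
  define c where "c = 2 * norm h + norm k + 1"
  have c: "c > 0" using norm_ge_zero[of h] norm_ge_zero[of k] unfolding c_def by linarith
  define D where "D = (\<lambda>y. frechet_derivative f (at y) h)"
  obtain d0 where d0: "d0 > 0"
    "\<And>y. norm (y - x) < d0 \<Longrightarrow> norm (D y - D x - B (y - x)) \<le> e / c * norm (y - x)"
    using B e c unfolding has_derivative_at_alt D_def by (metis divide_pos_pos)
  have linB: "linear B" using B has_derivative_linear by blast
  obtain r where r: "r > 0" "ball x r \<subseteq> S" using S open_contains_ball by blast
  define d where "d = min r d0 / c"
  have "norm (f (x + s *\<^sub>R h + s *\<^sub>R k) - f (x + s *\<^sub>R h) - f (x + s *\<^sub>R k) + f x - (s * s) *\<^sub>R B k) \<le> e * (s * s)"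
    if s: "0 < s" "s < d" for s
  proof -
    have sc: "s * c < min r d0" using s c by (simp add: d_def pos_less_divide_eq)
    have n1: "norm (\<tau> *\<^sub>R h) \<le> s * norm h" if "\<tau> \<in> {0..s}" for \<tau>
      using that by (simp add: mult_right_mono)
    have n2: "norm (\<tau> *\<^sub>R h + s *\<^sub>R k) \<le> s * norm h + s * norm k" if "\<tau> \<in> {0..s}" for \<tau>
      by (rule order_trans[OF norm_triangle_ineq]) (use n1[OF that] s in auto)
    have small: "s * norm h < min r d0" "s * norm h + s * norm k < min r d0"
    proof -
      have "s * norm h + s * norm k \<le> s * c" "s * norm h \<le> s * c"
        using s by (auto simp: c_def algebra_simps)
      then show "s * norm h < min r d0" "s * norm h + s * norm k < min r d0" using sc by linarith+
    qed
    define g where "g = (\<lambda>\<tau>. f (x + \<tau> *\<^sub>R h + s *\<^sub>R k) - f (x + \<tau> *\<^sub>R h) - (\<tau> * s) *\<^sub>R B k)"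
    define g' where "g' = (\<lambda>\<tau>. D (x + \<tau> *\<^sub>R h + s *\<^sub>R k) - D (x + \<tau> *\<^sub>R h) - s *\<^sub>R B k)"
    have line: "((\<lambda>\<tau>. f (z + \<tau> *\<^sub>R h)) has_derivative (\<lambda>t. t *\<^sub>R D (z + \<tau> *\<^sub>R h))) (at \<tau> within T)"
      if "z + \<tau> *\<^sub>R h \<in> S" for z \<tau> T
    proof -
      have fd: "(f has_derivative frechet_derivative f (at (z + \<tau> *\<^sub>R h))) (at (z + \<tau> *\<^sub>R h))"
        using f[OF that] by (simp add: frechet_derivative_works)
      have "((\<lambda>\<tau>. z + \<tau> *\<^sub>R h) has_derivative (\<lambda>t. t *\<^sub>R h)) (at \<tau> within T)"
        by (auto intro!: derivative_eq_intros)
      from has_derivative_compose[OF this fd] show ?thesis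
        using linear_cmul[OF has_derivative_linear[OF fd]] by (simp add: D_def)
    qed
    have gd: "(g has_derivative (\<lambda>t. t *\<^sub>R g' \<tau>)) (at \<tau> within {0..s})" if \<tau>: "\<tau> \<in> {0..s}" for \<tau>
    proof -
      have "x + \<tau> *\<^sub>R h \<in> ball x r"
        using n1[OF \<tau>] small by (simp add: dist_norm)
      then have S1: "x + \<tau> *\<^sub>R h \<in> S" using r by blast
      have "x + s *\<^sub>R k + \<tau> *\<^sub>R h \<in> ball x r"
        using n2[OF \<tau>] small by (simp add: dist_norm norm_minus_commute add.commute[of _ "\<tau> *\<^sub>R h"])
      then have S2: "x + s *\<^sub>R k + \<tau> *\<^sub>R h \<in> S" using r by blast
      have "((\<lambda>\<tau>. f (x + s *\<^sub>R k + \<tau> *\<^sub>R h) - f (x + \<tau> *\<^sub>R h) - (\<tau> * s) *\<^sub>R B k) has_derivative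
          (\<lambda>t. t *\<^sub>R D (x + s *\<^sub>R k + \<tau> *\<^sub>R h) - t *\<^sub>R D (x + \<tau> *\<^sub>R h) - (t * s) *\<^sub>R B k)) (at \<tau> within {0..s})"
        by (intro has_derivative_diff line S1 S2) (auto intro!: derivative_eq_intros)
      then show ?thesis
        unfolding g_def g'_def by (simp add: scaleR_diff_right add.commute add.left_commute)
    qed
    have bound: "norm (g' \<tau>) \<le> e * s" if \<tau>: "\<tau> \<in> {0..s}" for \<tau>
    proof -
      have "norm (\<tau> *\<^sub>R h + s *\<^sub>R k) < d0" using n2[OF \<tau>] small by linarith
      then have 1: "norm (D (x + \<tau> *\<^sub>R h + s *\<^sub>R k) - D x - B (\<tau> *\<^sub>R h + s *\<^sub>R k)) \<le> e / c * norm (\<tau> *\<^sub>R h + s *\<^sub>R k)"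
        using d0(2)[of "x + \<tau> *\<^sub>R h + s *\<^sub>R k"] by (simp add: add.assoc)
      have "norm (\<tau> *\<^sub>R h) < d0" using n1[OF \<tau>] small by linarith
      then have 2: "norm (D (x + \<tau> *\<^sub>R h) - D x - B (\<tau> *\<^sub>R h)) \<le> e / c * norm (\<tau> *\<^sub>R h)"
        using d0(2)[of "x + \<tau> *\<^sub>R h"] by simp
      have "norm (g' \<tau>) = norm ((D (x + \<tau> *\<^sub>R h + s *\<^sub>R k) - D x - B (\<tau> *\<^sub>R h + s *\<^sub>R k))
          - (D (x + \<tau> *\<^sub>R h) - D x - B (\<tau> *\<^sub>R h)))"
        unfolding g'_def by (simp add: linear_add[OF linB] linear_cmul[OF linB] algebra_simps)
      also have "\<dots> \<le> e / c * norm (\<tau> *\<^sub>R h + s *\<^sub>R k) + e / c * norm (\<tau> *\<^sub>R h)"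
        using norm_triangle_ineq4 1 2 by (rule order_trans[OF _ add_mono])
      also have "\<dots> \<le> e / c * (s * norm h + s * norm k) + e / c * (s * norm h)"
        using e c n1[OF \<tau>] n2[OF \<tau>] by (intro add_mono mult_left_mono) auto
      also have "\<dots> = e / c * (s * (c - 1))"
      proof -
        have "c - 1 = norm h + norm k + norm h" by (simp add: c_def)
        then show ?thesis by (simp only: distrib_left)
      qed
      also have "\<dots> \<le> e / c * (s * c)" using e c s by (intro mult_left_mono) auto
      also have "\<dots> = e * s" using c by simp
      finally show ?thesis .
    qed
    have "norm (g s - g 0) \<le> e * s * norm (s - 0)"
    proof (rule differentiable_bound[where S = "{0..s}" and f' = "\<lambda>\<tau> t. t *\<^sub>R g' \<tau>"])
      show "onorm (\<lambda>t. t *\<^sub>R g' \<tau>) \<le> e * s" if "\<tau> \<in> {0..s}" for \<tau>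
        by (rule onorm_bound) (use bound[OF that] e s in \<open>auto simp: mult.commute intro: mult_left_mono\<close>)
    qed (use gd s in auto)
    then show ?thesis using s by (simp add: g_def algebra_simps)
  qed
  moreover have "d > 0" using r d0 c by (simp add: d_def)
  ultimately show ?thesis by blast
qed

text \<open>The second difference is symmetric in \<open>h\<close> and \<open>k\<close>, and divided
  by s^2 it approaches both \<open>B k\<close> and \<open>C h\<close>. With a tolerance of one third
  of their distance, two errors cannot bridge the gap.\<close>

lemma mixed_partials_commute:
  fixes f :: "'a::real_normed_vector \<Rightarrow> 'b::real_normed_vector"
  assumes S: "open S" "x \<in> S" and f: "\<And>y. y \<in> S \<Longrightarrow> f differentiable (at y)"
    and B: "((\<lambda>y. frechet_derivative f (at y) h) has_derivative B) (at x)"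
    and C: "((\<lambda>y. frechet_derivative f (at y) k) has_derivative C) (at x)"
  shows "B k = C h"
proof (rule ccontr)
  assume "B k \<noteq> C h"
  define e where "e = norm (B k - C h) / 3"
  have e: "e > 0" using \<open>B k \<noteq> C h\<close> by (simp add: e_def)
  define \<Delta> where "\<Delta> = (\<lambda>s. f (x + s *\<^sub>R h + s *\<^sub>R k) - f (x + s *\<^sub>R h) - f (x + s *\<^sub>R k) + f x)"
  have \<Delta>': "\<Delta> s = f (x + s *\<^sub>R k + s *\<^sub>R h) - f (x + s *\<^sub>R k) - f (x + s *\<^sub>R h) + f x" for s
    by (simp add: \<Delta>_def algebra_simps)
  obtain d1 where d1: "d1 > 0" "\<And>s. 0 < s \<Longrightarrow> s < d1 \<Longrightarrow> norm (\<Delta> s - (s * s) *\<^sub>R B k) \<le> e * (s * s)"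
    using second_difference[OF S f B e, of k] unfolding \<Delta>_def by blast
  obtain d2 where d2: "d2 > 0" "\<And>s. 0 < s \<Longrightarrow> s < d2 \<Longrightarrow> norm (\<Delta> s - (s * s) *\<^sub>R C h) \<le> e * (s * s)"
    using second_difference[OF S f C e, of h] unfolding \<Delta>' by blast
  define s where "s = min d1 d2 / 2"
  have s: "0 < s" "s < d1" "s < d2" using d1 d2 by (auto simp: s_def)
  have "(s * s) * norm (B k - C h) = norm ((s * s) *\<^sub>R (B k - C h))" by simp
  also have "\<dots> = norm ((\<Delta> s - (s * s) *\<^sub>R C h) - (\<Delta> s - (s * s) *\<^sub>R B k))"
    by (simp add: scaleR_diff_right)
  also have "\<dots> \<le> e * (s * s) + e * (s * s)"
    using norm_triangle_ineq4 d2(2)[OF s(1,3)] d1(2)[OF s(1,2)] by (rule order_trans[OF _ add_mono])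
  finally have "(s * s) * norm (B k - C h) \<le> (s * s) * (2 * e)" by (simp add: algebra_simps)
  then have "norm (B k - C h) \<le> 2 * e" using s by simp
  then show False using e by (simp add: e_def)
qed

section \<open>Cross products, the curl and the tangent plane\<close>

lemma cross_axis_nonzero:
  fixes D :: "real^2 \<Rightarrow> real^3"
  assumes D: "linear D" "inj D"
  shows "cross3 (D (axis 1 1)) (D (axis 2 1)) \<noteq> 0"
proof
  have inj0: "D z = 0 \<Longrightarrow> z = 0" for z using linear_injective_0[OF D(1)] D(2) by blast
  have ax: "axis 1 1 \<noteq> (0::real^2)" "axis 2 1 \<noteq> (0::real^2)" by (auto simp: axis_eq_0_iff)
  assume "cross3 (D (axis 1 1)) (D (axis 2 1)) = 0"
  then have "D (axis 1 1) = 0 \<or> D (axis 2 1) = 0 \<or> (\<exists>c. D (axis 2 1) = c *\<^sub>R D (axis 1 1))"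
    unfolding cross_eq_0 collinear_lemma .
  then obtain c where "D (axis 2 1) = c *\<^sub>R D (axis 1 1)" using inj0 ax by blast
  then have "D (axis 2 1 - c *\<^sub>R axis 1 1) = 0"
    by (simp add: linear_diff[OF D(1)] linear_cmul[OF D(1)])
  then have "axis 2 1 - c *\<^sub>R axis 1 1 = (0::real^2)" by (rule inj0)
  then have "(axis 2 1 - c *\<^sub>R axis 1 1 :: real^2) $ 2 = 0" by simp
  then show False by (simp add: axis_def)
qed

lemma linear_axis_2:
  fixes D :: "real^2 \<Rightarrow> 'b::real_vector"
  assumes D: "linear D"
  shows "D h = (h $ 1) *\<^sub>R D (axis 1 1) + (h $ 2) *\<^sub>R D (axis 2 1)"
proof -
  have "h = (h $ 1) *\<^sub>R axis 1 1 + (h $ 2) *\<^sub>R axis 2 1"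
    by (simp add: vec_eq_iff forall_2 axis_def)
  then have "D h = D ((h $ 1) *\<^sub>R axis 1 1 + (h $ 2) *\<^sub>R axis 2 1)" by simp
  then show ?thesis by (simp add: linear_add[OF D] linear_cmul[OF D])
qed

lemma orthogonal_to_plane:
  fixes a b n :: "real^3"
  assumes "cross3 a b \<noteq> 0" "n \<bullet> a = 0" "n \<bullet> b = 0"
  obtains c where "n = c *\<^sub>R (cross3 a b)"
proof -
  have "cross3 (cross3 a b) n = 0"
    using assms(2,3) by (simp add: Lagrange cross_skew[of "cross3 a b" n])
  then show ?thesis
    using assms(1) that unfolding cross_eq_0 collinear_lemma by (metis scaleR_zero_left)
qed

text \<open>The curl is the axial vector of the antisymmetric part of the Jacobian, J - J^T.\<close>

lemma curl_cross:
  "curl r x \<bullet> (cross3 a b) = (jacobian r (at x) *v a) \<bullet> b - (jacobian r (at x) *v b) \<bullet> a"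
  unfolding curl_def Let_def
  by (simp add: cross3_def inner_vec_def sum_3 matrix_vector_mult_def algebra_simps)

text \<open>Differentiating \<open>r \<bullet> D\<phi> h = 0\<close> along the surface and antisymmetrising removes the second
  derivatives of \<open>\<phi>\<close> and leaves the component of the curl along the normal.\<close>

lemma helicity_normal_field:
  fixes \<phi> :: "real^2 \<Rightarrow> real^3" and r :: "real^3 \<Rightarrow> real^3"
  assumes V: "open V" "u \<in> V" and \<phi>: "Ck_on (Suc (Suc 0)) V \<phi>"
    and inj: "inj (frechet_derivative \<phi> (at u))"
    and r: "r differentiable (at (\<phi> u))"
    and normal: "\<And>y h. y \<in> V \<Longrightarrow> r (\<phi> y) \<bullet> frechet_derivative \<phi> (at y) h = 0"
  shows "helicity r (\<phi> u) = 0"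
proof -
  define J where "J = jacobian r (at (\<phi> u))"
  define D where "D = frechet_derivative \<phi> (at u)"
  define B where "B = (\<lambda>h. frechet_derivative (\<lambda>y. frechet_derivative \<phi> (at y) h) (at u))"
  have \<phi>': "\<phi> differentiable (at y)" if "y \<in> V" for y using \<phi> that by simp
  have D: "(\<phi> has_derivative D) (at u)" unfolding D_def using \<phi>'[OF V(2)] by (simp add: frechet_derivative_works)
  have B: "((\<lambda>y. frechet_derivative \<phi> (at y) h) has_derivative B h) (at u)" for h
    unfolding B_def using \<phi> V(2) by (simp add: frechet_derivative_works)
  have sym: "B h k = B k h" for h k
    by (rule mixed_partials_commute[OF V \<phi>' B B])
  have J: "(r has_derivative (\<lambda>h. J *v h)) (at (\<phi> u))"
    using r unfolding J_def by (simp add: jacobian_works)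
  have key: "(J *v D k) \<bullet> D h = - (r (\<phi> u) \<bullet> B h k)" for h k
  proof -
    have "((\<lambda>y. r (\<phi> y) \<bullet> frechet_derivative \<phi> (at y) h) has_derivative
        (\<lambda>k. r (\<phi> u) \<bullet> B h k + (J *v D k) \<bullet> D h)) (at u)"
      using has_derivative_inner[OF has_derivative_compose[OF D J] B[of h]] by (simp add: D_def)
    moreover have "((\<lambda>y. r (\<phi> y) \<bullet> frechet_derivative \<phi> (at y) h) has_derivative (\<lambda>k. 0)) (at u)"
      by (rule has_derivative_transform_within_open[OF has_derivative_const[of 0] V]) (simp add: normal)
    ultimately have "(\<lambda>k. r (\<phi> u) \<bullet> B h k + (J *v D k) \<bullet> D h) = (\<lambda>k. 0)"
      by (rule has_derivative_unique)
    then show ?thesis using fun_cong[of _ _ k] by (smt (verit))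
  qed
  define a b where "a = D (axis 1 1)" and "b = D (axis 2 1)"
  have "curl r (\<phi> u) \<bullet> (cross3 a b) = 0"
    unfolding curl_cross a_def b_def J_def[symmetric] key sym[of "axis 1 1" "axis 2 1"] by simp
  moreover obtain c where "r (\<phi> u) = c *\<^sub>R (cross3 a b)"
  proof (rule orthogonal_to_plane)
    show "cross3 a b \<noteq> 0" unfolding a_def b_def
      using has_derivative_linear[OF D] inj D_def by (intro cross_axis_nonzero) auto
    show "r (\<phi> u) \<bullet> a = 0" "r (\<phi> u) \<bullet> b = 0"
      using normal[OF V(2)] by (simp_all add: a_def b_def D_def)
  qed
  ultimately show ?thesis by (simp add: helicity_def)
qed

section \<open>Extremal directions of repulsion and shear\<close>

lemma orthonormal_expansion:
  fixes e :: "'n::finite \<Rightarrow> real^'n"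
  assumes e: "\<And>i j. e i \<bullet> e j = (if i = j then 1 else 0)"
  shows "x = (\<Sum>i\<in>UNIV. (x \<bullet> e i) *\<^sub>R e i)"
proof -
  define E where "E = (\<chi> i. e i)"
  have "E ** transpose E = mat 1"
    using e by (simp add: E_def vec_eq_iff matrix_matrix_mult_def transpose_def mat_def inner_vec_def)
  then have "transpose E ** E = mat 1" using matrix_left_right_inverse by blast
  then have "x = transpose E *v (E *v x)" by (simp add: matrix_vector_mul_assoc)
  also have "\<dots> = (\<Sum>i\<in>UNIV. (x \<bullet> e i) *\<^sub>R e i)"
    by (simp add: E_def matrix_vector_mult_def transpose_def vec_eq_iff inner_vec_def sum_component mult.commute)
  finally show ?thesis .
qed

text \<open>Normalization is not assumed, because besides the eigenbasis the lemma serves its image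
  under the flow gradient, where the squared lengths are the eigenvalues.\<close>

lemma norm_sum_orthogonal:
  fixes f :: "'n::finite \<Rightarrow> 'a::real_inner"
  assumes "\<And>i j. i \<noteq> j \<Longrightarrow> f i \<bullet> f j = 0"
  shows "(norm (\<Sum>i\<in>UNIV. c i *\<^sub>R f i))\<^sup>2 = (\<Sum>i\<in>UNIV. (c i)\<^sup>2 * (f i \<bullet> f i))"
proof -
  have "(c i *\<^sub>R f i) \<bullet> (\<Sum>j\<in>UNIV. c j *\<^sub>R f j) = (c i)\<^sup>2 * (f i \<bullet> f i)" for i
  proof -
    have "(c i *\<^sub>R f i) \<bullet> (\<Sum>j\<in>UNIV. c j *\<^sub>R f j) = (\<Sum>j\<in>UNIV. if j = i then (c i)\<^sup>2 * (f i \<bullet> f i) else 0)"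
      unfolding inner_sum_right
      by (rule sum.cong) (use assms in \<open>auto simp: power2_eq_square\<close>)
    then show ?thesis by simp
  qed
  then show ?thesis unfolding power2_norm_eq_inner inner_sum_left by simp
qed

lemma matrix_cancel: "A ** B = mat 1 \<Longrightarrow> A *v (B *v z) = z" for A B :: "real^'n^'n"
  by (metis matrix_vector_mul_assoc matrix_vector_mul_lid)

section \<open>Linear algebra of the strain tensor at one point\<close>

locale strain =
  fixes D :: "(real^3) set" and v :: "real^3 \<Rightarrow> real \<Rightarrow> real^3" and t0 T :: real and x :: "real^3"
    and l :: "real^3" and e :: "3 \<Rightarrow> real^3"
  assumes eigen: "orthonormal_eigenbasis (cauchy_green D v t0 T x) l e"
    and l_pos: "0 < l $ 1" and l12: "l $ 1 < l $ 2" and l23: "l $ 2 < l $ 3"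
begin

abbreviation "\<rho> \<equiv> normal_repulsion D v t0 T x"
abbreviation "\<sigma> \<equiv> tangential_shear D v t0 T x"
abbreviation "F \<equiv> flow_gradient D v t0 T x"

lemma l_positive: "0 < l $ i"
  using l_pos l12 l23 exhaust_3[of i] by (metis less_trans)

lemma e_orthonormal: "e i \<bullet> e j = (if i = j then 1 else 0)"
  using eigen by (simp add: orthonormal_eigenbasis_def)

lemma norm_e: "norm (e i) = 1"
  using e_orthonormal[of i i] by (simp add: norm_eq_1)

lemma norm_expansion: "(norm n)\<^sup>2 = (\<Sum>i\<in>UNIV. (n \<bullet> e i)\<^sup>2)"
  using norm_sum_orthogonal[of e "\<lambda>i. n \<bullet> e i"] orthonormal_expansion[of e n] e_orthonormal by simp

lemma F_transpose_F: "transpose F *v (F *v e i) = l $ i *\<^sub>R e i"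
  using eigen by (simp add: orthonormal_eigenbasis_def cauchy_green_def matrix_vector_mul_assoc)

lemma inner_F_e: "(F *v e i) \<bullet> (F *v e j) = (if i = j then l $ i else 0)"
proof -
  have "(F *v e i) \<bullet> (F *v e j) = (transpose F *v (F *v e i)) \<bullet> e j"
    by (metis dot_lmul_matrix transpose_matrix_vector transpose_transpose vector_transpose_matrix)
  then show ?thesis unfolding F_transpose_F by (simp add: e_orthonormal)
qed

lemma norm_F: "(norm (F *v n))\<^sup>2 = (\<Sum>i\<in>UNIV. (n \<bullet> e i)\<^sup>2 * l $ i)"
proof -
  have "F *v n = F *v (\<Sum>i\<in>UNIV. (n \<bullet> e i) *\<^sub>R e i)"
    using orthonormal_expansion[of e n] e_orthonormal by simp
  also have "\<dots> = (\<Sum>i\<in>UNIV. (n \<bullet> e i) *\<^sub>R (F *v e i))"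
    by (simp add: linear_sum[OF matrix_vector_mul_linear] linear_cmul[OF matrix_vector_mul_linear])
  finally show ?thesis
    using norm_sum_orthogonal[of "\<lambda>i. F *v e i" "\<lambda>i. n \<bullet> e i"] by (simp add: inner_F_e)
qed

text \<open>Since |F n|^2 is a combination of the squared coordinates of \<open>n\<close> with
  positive weights \<lambda>_i, the kernel of F is trivial. Invertibility gives
  \<open>matrix_inv\<close> its expected meaning.\<close>

lemma F_inverse: "matrix_inv F ** F = mat 1"
proof -
  have "F *v n \<noteq> 0" if "n \<noteq> 0" for n
  proof
    assume "F *v n = 0"
    then have "(\<Sum>i\<in>UNIV. (n \<bullet> e i)\<^sup>2 * l $ i) = 0" using norm_F[of n] by simp
    then have "\<forall>i\<in>UNIV. (n \<bullet> e i)\<^sup>2 * l $ i = 0"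
      by (subst (asm) sum_nonneg_eq_0_iff) (auto simp: less_imp_le[OF l_positive])
    then have "n \<bullet> e i = 0" for i using l_positive[of i] by (metis UNIV_I less_irrefl mult_eq_0_iff power2_eq_iff_nonneg zero_eq_power2)
    then have "(norm n)\<^sup>2 = 0" unfolding norm_expansion by simp
    then show False using that by simp
  qed
  then have "\<exists>B. B ** F = mat 1" unfolding matrix_left_invertible_ker by blast
  then have "invertible F" using invertible_left_inverse by blast
  then show ?thesis unfolding matrix_inv_def invertible_def by (rule someI_ex[THEN conjunct2])
qed

text \<open>Applying the inverse transpose to F^T F e_i = \<lambda>_i e_i shows that it maps e_i to
  F e_i / \<lambda>_i.\<close>

lemma advected_direction:
  "transpose (matrix_inv F) *v n = (\<Sum>i\<in>UNIV. ((n \<bullet> e i) / l $ i) *\<^sub>R (F *v e i))"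
proof -
  have inv: "transpose (matrix_inv F) ** transpose F = mat 1"
    by (metis F_inverse matrix_left_right_inverse matrix_transpose_mul transpose_mat)
  have "l $ i *\<^sub>R (transpose (matrix_inv F) *v e i) = F *v e i" for i
  proof -
    show ?thesis
      using matrix_cancel[OF inv, of "F *v e i"]
      unfolding F_transpose_F linear_cmul[OF matrix_vector_mul_linear] .
  qed
  moreover have l_nonzero: "l $ i \<noteq> 0" for i using l_positive[of i] by simp
  ultimately have "(1 / l $ i) *\<^sub>R (l $ i *\<^sub>R (transpose (matrix_inv F) *v e i)) = (1 / l $ i) *\<^sub>R (F *v e i)" for i
    by simp
  then have 1: "transpose (matrix_inv F) *v e i = (1 / l $ i) *\<^sub>R (F *v e i)" for i
    using l_nonzero by (simp del: transpose_matrix_vector)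
  have "transpose (matrix_inv F) *v n = transpose (matrix_inv F) *v (\<Sum>i\<in>UNIV. (n \<bullet> e i) *\<^sub>R e i)"
    using orthonormal_expansion[of e n] e_orthonormal by simp
  also have "\<dots> = (\<Sum>i\<in>UNIV. (n \<bullet> e i) *\<^sub>R (transpose (matrix_inv F) *v e i))"
    by (simp add: linear_sum[OF matrix_vector_mul_linear] linear_cmul[OF matrix_vector_mul_linear])
  finally show ?thesis by (simp only: 1 scaleR_scaleR times_divide_eq_right mult_1_right)
qed

text \<open>The quadratic form of the inverse Cauchy-Green tensor; it equals the squared length of
  the advected normal before normalization.\<close>

definition compression :: "real^3 \<Rightarrow> real" where
  "compression n = (\<Sum>i\<in>UNIV. (n \<bullet> e i)\<^sup>2 / l $ i)"

lemma norm_advected_direction: "(norm (transpose (matrix_inv F) *v n))\<^sup>2 = compression n"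
proof -
  have "(norm (transpose (matrix_inv F) *v n))\<^sup>2 = (\<Sum>i\<in>UNIV. ((n \<bullet> e i) / l $ i)\<^sup>2 * l $ i)"
    unfolding advected_direction
    using norm_sum_orthogonal[of "\<lambda>i. F *v e i" "\<lambda>i. (n \<bullet> e i) / l $ i"] by (simp add: inner_F_e)
  also have "\<dots> = compression n"
    unfolding compression_def using l_positive
    by (intro sum.cong refl) (simp add: power2_eq_square less_imp_neq[symmetric])
  finally show ?thesis .
qed

lemma compression_pos: "n \<noteq> 0 \<Longrightarrow> 0 < compression n"
proof -
  assume "n \<noteq> 0"
  have "transpose (matrix_inv F) *v n \<noteq> 0"
  proof
    assume "transpose (matrix_inv F) *v n = 0"
    then have "transpose F *v (transpose (matrix_inv F) *v n) = 0" by simp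
    moreover have "transpose F ** transpose (matrix_inv F) = mat 1"
      by (metis F_inverse matrix_transpose_mul transpose_mat)
    ultimately show False using \<open>n \<noteq> 0\<close> matrix_cancel by metis
  qed
  then show ?thesis unfolding norm_advected_direction[symmetric] by simp
qed

text \<open>The inner product of F^{-*} n with F n is |n|^2 = 1, so only the normalizing length of
  F^{-*} n remains.\<close>

lemma repulsion_eq:
  assumes "norm n = 1"
  shows "\<rho> n = 1 / sqrt (compression n)"
proof -
  define m where "m = transpose (matrix_inv F) *v n"
  have "m \<bullet> (F *v n) = n \<bullet> (matrix_inv F *v (F *v n))"
    unfolding m_def by (metis dot_lmul_matrix transpose_matrix_vector)
  also have "\<dots> = 1" using assms by (simp add: matrix_vector_mul_assoc F_inverse norm_eq_1)
  finally have "m \<bullet> (F *v n) = 1" .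
  moreover have "norm m = sqrt (compression n)"
    unfolding norm_advected_direction[symmetric] m_def by simp
  ultimately show ?thesis
    unfolding normal_repulsion_def advected_normal_def Let_def m_def[symmetric]
    by (simp add: inverse_eq_divide)
qed

text \<open>Pythagoras: the shear is what is left of F n after removing its component \<rho> along
  the advected unit normal.\<close>

lemma shear_eq:
  assumes "norm n = 1"
  shows "(\<sigma> n)\<^sup>2 = (\<Sum>i\<in>UNIV. (n \<bullet> e i)\<^sup>2 * l $ i) - 1 / compression n"
proof -
  define m where "m = advected_normal D v t0 T x n"
  define w where "w = F *v n"
  have n0: "n \<noteq> 0" using assms by auto
  have "norm m = 1"
    using compression_pos[OF n0] unfolding norm_advected_direction[symmetric] m_def advected_normal_def Let_def
    by simp
  then have mm: "m \<bullet> m = 1" by (simp add: norm_eq_1)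
  have "(norm (w - (m \<bullet> w) *\<^sub>R m))\<^sup>2 = (norm w)\<^sup>2 - (m \<bullet> w)\<^sup>2"
    unfolding power2_norm_eq_inner
    by (simp add: inner_diff_left inner_diff_right mm inner_commute power2_eq_square)
  moreover have "m \<bullet> w = \<rho> n" by (simp add: normal_repulsion_def m_def w_def)
  moreover have "(\<rho> n)\<^sup>2 = 1 / compression n"
    unfolding repulsion_eq[OF assms] using compression_pos[OF n0] by (simp add: power_divide)
  ultimately show ?thesis
    unfolding tangential_shear_def Let_def m_def[symmetric] w_def[symmetric]
    using norm_F[of n] by (simp add: w_def)
qed

lemma compression_e: "compression (e i) = 1 / l $ i"
proof -
  have "compression (e i) = (\<Sum>j\<in>UNIV. if j = i then 1 / l $ i else 0)"
    unfolding compression_def by (rule sum.cong) (auto simp: e_orthonormal)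
  then show ?thesis by simp
qed

text \<open>On the unit sphere the compression is a convex combination of the values 1 /
  \<lambda>_i. Weak bounds suffice, since the comparison in the definitions of hyperbolic structures
  is strict.\<close>

lemma repulsion_bounds:
  assumes "norm n = 1"
  shows "\<rho> (e 1) \<le> \<rho> n" "\<rho> n \<le> \<rho> (e 3)"
proof -
  have le: "l $ 1 \<le> l $ i" "l $ i \<le> l $ 3" for i
    using l12 l23 exhaust_3[of i] by auto
  have sum1: "(\<Sum>i\<in>UNIV. (n \<bullet> e i)\<^sup>2) = 1" using norm_expansion[of n] assms by simp
  have n0: "n \<noteq> 0" using assms by auto
  have "compression n \<le> (\<Sum>i\<in>UNIV. (n \<bullet> e i)\<^sup>2 / l $ 1)"
    unfolding compression_def using le l_positive
    by (intro sum_mono divide_left_mono) auto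
  then have 1: "compression n \<le> compression (e 1)"
    by (simp add: compression_e sum1 flip: sum_divide_distrib)
  have "(\<Sum>i\<in>UNIV. (n \<bullet> e i)\<^sup>2 / l $ 3) \<le> compression n"
    unfolding compression_def using le l_positive
    by (intro sum_mono divide_left_mono) auto
  then have 3: "compression (e 3) \<le> compression n"
    by (simp add: compression_e sum1 flip: sum_divide_distrib)
  have pos: "0 < compression (e 3)" using l_positive[of 3] by (simp add: compression_e)
  show "\<rho> (e 1) \<le> \<rho> n" "\<rho> n \<le> \<rho> (e 3)"
    unfolding repulsion_eq[OF assms] repulsion_eq[OF norm_e]
    using 1 3 pos compression_pos[OF n0] by (auto intro!: divide_left_mono)
qed

text \<open>With \<open>\<alpha> = sqrt \<lambda>\<^sub>1\<close>, \<open>\<gamma> = sqrt \<lambda>\<^sub>3\<close>, \<open>A = \<Sum> \<lambda>\<^sub>i n\<^sub>i\<^sup>2\<close> and \<open>B = \<Sum> n\<^sub>i\<^sup>2 / \<lambda>\<^sub>i\<close>, the identity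
  \<open>\<lambda> + \<alpha>\<^sup>2 \<gamma>\<^sup>2 / \<lambda> = \<alpha>\<^sup>2 + \<gamma>\<^sup>2\<close> at \<open>\<lambda>\<^sub>1, \<lambda>\<^sub>3\<close>, with a deficit \<open>\<kappa> > 0\<close> at \<open>\<lambda>\<^sub>2\<close>, gives
  \<open>A - 1 / B = (\<gamma> - \<alpha>)\<^sup>2 - \<kappa> n\<^sub>2\<^sup>2 - (\<alpha> \<gamma> B - 1)\<^sup>2 / B\<close>.\<close>

lemma shear_maximal:
  assumes n: "norm n = 1"
    and max: "(sqrt (l $ 3) - sqrt (l $ 1))\<^sup>2 \<le> (\<sigma> n)\<^sup>2"
  shows "n \<bullet> e 2 = 0"
    "(n \<bullet> e 1)\<^sup>2 = sqrt (l $ 1) / (sqrt (l $ 1) + sqrt (l $ 3))"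
    "(n \<bullet> e 3)\<^sup>2 = sqrt (l $ 3) / (sqrt (l $ 1) + sqrt (l $ 3))"
proof -
  define \<alpha> \<gamma> \<beta> where "\<alpha> = sqrt (l $ 1)" and "\<gamma> = sqrt (l $ 3)" and "\<beta> = l $ 2"
  have l: "l $ 1 = \<alpha>\<^sup>2" "l $ 3 = \<gamma>\<^sup>2" using l_positive[of 1] l_positive[of 3] by (auto simp: \<alpha>_def \<gamma>_def)
  have pos: "0 < \<alpha>" "0 < \<gamma>" "0 < \<beta>" using l_positive by (auto simp: \<alpha>_def \<gamma>_def \<beta>_def)
  have lt: "\<alpha> < \<gamma>" "\<alpha>\<^sup>2 < \<beta>" "\<beta> < \<gamma>\<^sup>2" using l12 l23 unfolding l[symmetric] by (auto simp: \<alpha>_def \<gamma>_def \<beta>_def)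
  define p q r where "p = (n \<bullet> e 1)\<^sup>2" and "q = (n \<bullet> e 2)\<^sup>2" and "r = (n \<bullet> e 3)\<^sup>2"
  have sum1: "p + q + r = 1" using norm_expansion[of n] n by (simp add: sum_3 p_def q_def r_def)
  define B where "B = compression n"
  have B: "B = p / \<alpha>\<^sup>2 + q / \<beta> + r / \<gamma>\<^sup>2"
    unfolding B_def compression_def by (simp add: sum_3 p_def q_def r_def l \<beta>_def)
  have Bpos: "0 < B" unfolding B_def using n by (intro compression_pos) auto
  \<comment> \<open>This is \<alpha>^2 + \<gamma>^2 - \<beta> - \<alpha>^2 \<gamma>^2 / \<beta> in
    factored form; its positivity expresses that \<lambda>_2 lies strictly between the other two
    eigenvalues.\<close>
  define \<kappa> where "\<kappa> = (\<beta> - \<alpha>\<^sup>2) * (\<gamma>\<^sup>2 - \<beta>) / \<beta>"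
  have \<kappa>: "0 < \<kappa>" using lt pos by (simp add: \<kappa>_def)
  have "(\<sigma> n)\<^sup>2 = p * \<alpha>\<^sup>2 + q * \<beta> + r * \<gamma>\<^sup>2 - 1 / B"
    unfolding shear_eq[OF n] B_def by (simp add: sum_3 p_def q_def r_def l \<beta>_def)
  also have "\<dots> = (\<gamma> - \<alpha>)\<^sup>2 - \<kappa> * q - (\<alpha> * \<gamma> * B - 1)\<^sup>2 / B"
  proof -
    have "p * \<alpha>\<^sup>2 + q * \<beta> + r * \<gamma>\<^sup>2 + (\<alpha> * \<gamma>)\<^sup>2 * B = (\<alpha>\<^sup>2 + \<gamma>\<^sup>2) * (p + q + r) - \<kappa> * q"
      unfolding B \<kappa>_def using pos by (simp add: field_simps power2_eq_square)
    moreover have "(\<alpha> * \<gamma> * B - 1)\<^sup>2 / B = (\<alpha> * \<gamma>)\<^sup>2 * B - 2 * \<alpha> * \<gamma> + 1 / B"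
      using Bpos by (simp add: field_simps power2_eq_square)
    ultimately show ?thesis by (simp add: sum1 power2_diff)
  qed
  finally have "\<kappa> * q + (\<alpha> * \<gamma> * B - 1)\<^sup>2 / B \<le> 0"
    using max by (simp add: \<alpha>_def \<gamma>_def)
  moreover have "0 \<le> \<kappa> * q" "0 \<le> (\<alpha> * \<gamma> * B - 1)\<^sup>2 / B" using \<kappa> Bpos by (auto simp: q_def)
  ultimately have "\<kappa> * q = 0" "(\<alpha> * \<gamma> * B - 1)\<^sup>2 / B = 0" by linarith+
  then have q: "q = 0" and B1: "\<alpha> * \<gamma> * B = 1" using \<kappa> Bpos by auto
  have r: "r = 1 - p" using sum1 q by simp
  \<comment> \<open>With q = 0 and r = 1 - p, the condition \<alpha> \<gamma> B = 1 is linear in p,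
    and the nonzero factor \<gamma> - \<alpha> cancels.\<close>
  have "\<alpha> * \<gamma> * (\<alpha> * \<gamma> * B) = \<gamma> * \<gamma> * p + \<alpha> * \<alpha> * (1 - p)"
    unfolding B q r using pos by (simp add: field_simps power2_eq_square)
  then have "\<gamma> * \<gamma> * p + \<alpha> * \<alpha> * (1 - p) = \<alpha> * \<gamma>" unfolding B1 by simp
  then have "(\<gamma> - \<alpha>) * ((\<alpha> + \<gamma>) * p - \<alpha>) = 0" by (simp add: algebra_simps)
  then have "(\<alpha> + \<gamma>) * p - \<alpha> = 0" using lt(1) by (simp only: mult_eq_0_iff) simp
  then have p: "p = \<alpha> / (\<alpha> + \<gamma>)" using pos by (simp add: field_simps)
  show "n \<bullet> e 2 = 0" using q by (simp add: q_def)
  show "(n \<bullet> e 1)\<^sup>2 = sqrt (l $ 1) / (sqrt (l $ 1) + sqrt (l $ 3))"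
    using p by (simp add: p_def \<alpha>_def \<gamma>_def)
  have "r = \<gamma> / (\<alpha> + \<gamma>)" unfolding r p using pos by (simp add: field_simps)
  then show "(n \<bullet> e 3)\<^sup>2 = sqrt (l $ 3) / (sqrt (l $ 1) + sqrt (l $ 3))"
    by (simp add: r_def \<alpha>_def \<gamma>_def)
qed

definition shear_direction :: "real \<Rightarrow> real^3" where
  "shear_direction s = sqrt (sqrt (l $ 1) / (sqrt (l $ 1) + sqrt (l $ 3))) *\<^sub>R e 1
     + (s * sqrt (sqrt (l $ 3) / (sqrt (l $ 1) + sqrt (l $ 3)))) *\<^sub>R e 3"

lemma shear_direction_inner:
  "shear_direction s \<bullet> e 1 = sqrt (sqrt (l $ 1) / (sqrt (l $ 1) + sqrt (l $ 3)))"
  "shear_direction s \<bullet> e 2 = 0"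
  "shear_direction s \<bullet> e 3 = s * sqrt (sqrt (l $ 3) / (sqrt (l $ 1) + sqrt (l $ 3)))"
  by (simp_all add: shear_direction_def inner_add_left e_orthonormal)

text \<open>The upper bound (\<gamma> - \<alpha>)^2 for the squared shear is attained, so this
  direction can serve as the test competitor.\<close>

lemma shear_direction_1:
  "norm (shear_direction 1) = 1"
  "(\<sigma> (shear_direction 1))\<^sup>2 = (sqrt (l $ 3) - sqrt (l $ 1))\<^sup>2"
proof -
  define \<alpha> \<gamma> where "\<alpha> = sqrt (l $ 1)" and "\<gamma> = sqrt (l $ 3)"
  have l: "l $ 1 = \<alpha>\<^sup>2" "l $ 3 = \<gamma>\<^sup>2" using l_positive[of 1] l_positive[of 3] by (auto simp: \<alpha>_def \<gamma>_def)
  have pos: "0 < \<alpha>" "0 < \<gamma>" using l_positive by (auto simp: \<alpha>_def \<gamma>_def)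
  let ?n = "shear_direction 1"
  have n: "(?n \<bullet> e 1)\<^sup>2 = \<alpha> / (\<alpha> + \<gamma>)" "(?n \<bullet> e 2)\<^sup>2 = 0" "(?n \<bullet> e 3)\<^sup>2 = \<gamma> / (\<alpha> + \<gamma>)"
    using pos unfolding shear_direction_inner \<alpha>_def[symmetric] \<gamma>_def[symmetric] by simp_all
  have "(norm ?n)\<^sup>2 = \<alpha> / (\<alpha> + \<gamma>) + \<gamma> / (\<alpha> + \<gamma>)"
    unfolding norm_expansion sum_3 n by simp
  also have "\<dots> = 1" using pos by (simp flip: add_divide_distrib)
  finally have "norm ?n = 1 \<or> norm ?n = - 1" by (simp only: power2_eq_1_iff)
  then show norm1: "norm ?n = 1" using norm_ge_zero[of ?n] by linarith
  have B: "compression ?n = 1 / (\<alpha> * \<gamma>)"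
    unfolding compression_def sum_3 n l using pos by (simp add: divide_simps) (simp add: algebra_simps power2_eq_square)
  show "(\<sigma> ?n)\<^sup>2 = (sqrt (l $ 3) - sqrt (l $ 1))\<^sup>2"
    unfolding shear_eq[OF norm1] B sum_3 n \<alpha>_def[symmetric] \<gamma>_def[symmetric] l
    using pos by (simp add: divide_simps) (simp add: algebra_simps power2_eq_square)
qed

text \<open>A single competitor, \<open>shear_direction 1\<close>, is enough: either
  \<open>n\<close> is parallel to it, or the comparison makes \<open>n\<close> reach the upper bound
  and \<open>shear_maximal\<close> fixes the squares of its coordinates. Their relative sign selects
  the field.\<close>

lemma shear_extremal:
  assumes n: "norm n = 1"
    and max: "\<And>m. norm m = 1 \<Longrightarrow> \<not> collinear {0, n, m} \<Longrightarrow> \<sigma> m \<le> \<sigma> n"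
  shows "(n \<bullet> e 1) * (n \<bullet> e 3) \<noteq> 0"
    "\<exists>c. shear_direction (sgn ((n \<bullet> e 1) * (n \<bullet> e 3))) = c *\<^sub>R n"
proof -
  define a b where "a = sqrt (sqrt (l $ 1) / (sqrt (l $ 1) + sqrt (l $ 3)))"
    and "b = sqrt (sqrt (l $ 3) / (sqrt (l $ 1) + sqrt (l $ 3)))"
  have ab: "a > 0" "b > 0" using l_positive by (auto simp: a_def b_def intro!: divide_pos_pos add_pos_pos)
  have "n \<bullet> e 2 = 0 \<and> (n \<bullet> e 1)\<^sup>2 = a\<^sup>2 \<and> (n \<bullet> e 3)\<^sup>2 = b\<^sup>2"
  proof -
    have sq: "a\<^sup>2 = sqrt (l $ 1) / (sqrt (l $ 1) + sqrt (l $ 3))" "b\<^sup>2 = sqrt (l $ 3) / (sqrt (l $ 1) + sqrt (l $ 3))"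
      using less_imp_le[OF l_positive[of 1]] less_imp_le[OF l_positive[of 3]] by (auto simp: a_def b_def)
    show ?thesis
    proof (cases "collinear {0, n, shear_direction 1}")
      case True
      then obtain c where c: "shear_direction 1 = c *\<^sub>R n"
        using n shear_direction_1(1) unfolding collinear_lemma by (metis norm_zero zero_neq_one)
      then have "\<bar>c\<bar> = 1" using n shear_direction_1(1) by simp
      then have "n = c *\<^sub>R shear_direction 1" unfolding c by (auto simp: abs_if split: if_splits)
      with \<open>\<bar>c\<bar> = 1\<close> show ?thesis
        using shear_direction_inner[of 1]
        by (metis a_def b_def inner_scaleR_left mult.left_neutral mult_zero_right power2_abs abs_mult)
    next
      case False
      have "0 \<le> \<sigma> (shear_direction 1)" by (simp add: tangential_shear_def Let_def)
      then have "(sqrt (l $ 3) - sqrt (l $ 1))\<^sup>2 \<le> (\<sigma> n)\<^sup>2"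
        using max[OF shear_direction_1(1) False] unfolding shear_direction_1(2)[symmetric] by (intro power_mono)
      from shear_maximal[OF n this] show ?thesis by (simp add: sq)
    qed
  qed
  then have n2: "n \<bullet> e 2 = 0" and n1: "n \<bullet> e 1 = a \<or> n \<bullet> e 1 = - a" and n3: "n \<bullet> e 3 = b \<or> n \<bullet> e 3 = - b"
    by (auto simp: power2_eq_iff)
  show "(n \<bullet> e 1) * (n \<bullet> e 3) \<noteq> 0" using n1 n3 ab by auto
  have "n = (n \<bullet> e 1) *\<^sub>R e 1 + (n \<bullet> e 3) *\<^sub>R e 3"
    using orthonormal_expansion[of e n] e_orthonormal n2 by (simp add: sum_3)
  \<comment> \<open>The field has positive coefficient along e_1, so \<open>n\<close> must be
    multiplied by the sign of its own first coordinate.\<close>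
  then have "shear_direction (sgn ((n \<bullet> e 1) * (n \<bullet> e 3))) = sgn (n \<bullet> e 1) *\<^sub>R n"
    using n1 n3 ab unfolding shear_direction_def a_def[symmetric] b_def[symmetric]
    by (auto simp: sgn_mult) (metis add_uminus_conv_diff diff_minus_eq_add minus_add_distrib minus_diff_eq scaleR_minus_left)+
  then show "\<exists>c. shear_direction (sgn ((n \<bullet> e 1) * (n \<bullet> e 3))) = c *\<^sub>R n" by blast
qed

end

section \<open>Normals of surfaces\<close>

lemma Ck_on_subset: "Ck_on k S f \<Longrightarrow> R \<subseteq> S \<Longrightarrow> Ck_on k R f"
  by (induction k arbitrary: f) (auto intro: continuous_on_subset)

lemma Ck_on_const: "Ck_on k S (\<lambda>x. c)"
  by (induction k arbitrary: c) (auto simp: frechet_derivative_const)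

lemma smooth_on_affine:
  assumes "bounded_linear f"
  shows "smooth_on S (\<lambda>x. c + f x)"
proof -
  have d: "((\<lambda>x. c + f x) has_derivative f) (at x)" for x
    using bounded_linear.has_derivative[OF assms has_derivative_ident]
    by (auto intro!: derivative_eq_intros)
  have "Ck_on k S (\<lambda>x. c + f x)" for k
  proof (cases k)
    case 0
    then show ?thesis using has_derivative_continuous[OF d]
      by (auto intro!: continuous_at_imp_continuous_on)
  next
    case (Suc j)
    have "frechet_derivative (\<lambda>x. c + f x) (at x) = f" for x using d frechet_derivative_at by metis
    then show ?thesis using Suc d by (auto simp: Ck_on_const differentiable_def)
  qed
  then show ?thesis by (simp add: smooth_on_def)
qed

lemma local_parametrizationD:
  assumes "local_parametrization S V \<phi>"
  shows "open V" "Ck_on k V \<phi>" "u \<in> V \<Longrightarrow> inj (frechet_derivative \<phi> (at u))"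
    "u \<in> V \<Longrightarrow> (\<phi> has_derivative frechet_derivative \<phi> (at u)) (at u)"
    "u \<in> V \<Longrightarrow> linear (frechet_derivative \<phi> (at u))"
    "openin (top_of_set S) (\<phi> ` V)" "\<exists>\<psi>. homeomorphism V (\<phi> ` V) \<phi> \<psi>"
proof -
  show k: "open V" "Ck_on k V \<phi>" "u \<in> V \<Longrightarrow> inj (frechet_derivative \<phi> (at u))"
    "openin (top_of_set S) (\<phi> ` V)" "\<exists>\<psi>. homeomorphism V (\<phi> ` V) \<phi> \<psi>" for k
    using assms by (auto simp: local_parametrization_def smooth_on_def)
  show d: "(\<phi> has_derivative frechet_derivative \<phi> (at u)) (at u)" if "u \<in> V"
    using Ck_on_has_derivative[OF k(2) that] .
  show "linear (frechet_derivative \<phi> (at u))" if "u \<in> V"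
    using d[OF that] has_derivative_linear by blast
qed

text \<open>The surface is a small disc in the plane through \<open>x\<close> spanned by an
  orthonormal pair orthogonal to \<open>m\<close>; the coordinates along that pair give a continuous
  inverse of the parametrization.\<close>

lemma planar_surface:
  fixes m x :: "real^3"
  assumes U: "open U" "x \<in> U" and m: "norm m = 1"
  obtains N where "smooth_surface N" "x \<in> N" "N \<subseteq> U" "unit_normal N x m"
proof -
  obtain p0 where p0: "p0 \<noteq> 0" "orthogonal m p0"
    using orthogonal_to_vector_exists[of m] by auto
  define p where "p = p0 /\<^sub>R norm p0"
  define q where "q = cross3 m p"
  have np: "norm p = 1" and mp: "m \<bullet> p = 0"
    using p0 by (auto simp: p_def orthogonal_def)
  have mq: "m \<bullet> q = 0" and pq: "p \<bullet> q = 0" by (auto simp: q_def dot_cross_self)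
  have "(norm q)\<^sup>2 = 1" using norm_cross_dot[of m p] m np mp by (simp add: q_def)
  then have qq: "q \<bullet> q = 1" and pp: "p \<bullet> p = 1" using np by (auto simp: power2_norm_eq_inner norm_eq_1)
  define L where "L = (\<lambda>u::real^2. (u $ 1) *\<^sub>R p + (u $ 2) *\<^sub>R q)"
  have "linear L" unfolding L_def by (intro linearI) (auto simp: algebra_simps)
  then have L: "bounded_linear L" by (simp add: linear_conv_bounded_linear)
  define \<phi> where "\<phi> = (\<lambda>u. x + L u)"
  define \<psi> where "\<psi> = (\<lambda>z. (p \<bullet> (z - x)) *\<^sub>R axis 1 1 + (q \<bullet> (z - x)) *\<^sub>R axis 2 1 :: real^2)"
  have inv: "\<psi> (\<phi> u) = u" for u
    by (simp add: \<psi>_def \<phi>_def L_def axis_def vec_eq_iff forall_2 inner_add_right pp qq pq inner_commute[of q p])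
  have cont\<phi>: "continuous_on S \<phi>" for S
    unfolding \<phi>_def by (intro continuous_intros linear_continuous_on L)
  have cont\<psi>: "continuous_on S \<psi>" for S
    unfolding \<psi>_def by (intro continuous_intros)
  have "open (\<phi> -` U)" using cont\<phi> U(1) by (intro open_vimage) auto
  moreover have "0 \<in> \<phi> -` U" using U(2) \<open>linear L\<close> by (simp add: \<phi>_def linear_0)
  ultimately obtain r where r: "r > 0" "ball 0 r \<subseteq> \<phi> -` U" using open_contains_ball by blast
  define V where "V = ball (0::real^2) r"
  define N where "N = \<phi> ` V"
  have d: "frechet_derivative \<phi> (at u) = L" for u
  proof -
    have "(\<phi> has_derivative L) (at u)"
      unfolding \<phi>_def using bounded_linear.has_derivative[OF L has_derivative_ident]
      by (auto intro!: derivative_eq_intros)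
    then show ?thesis by (metis frechet_derivative_at)
  qed
  have "inj L"
  proof (rule injI)
    fix u v assume "L u = L v"
    then show "u = v" using inv[of u] inv[of v] by (simp add: \<phi>_def)
  qed
  have par: "local_parametrization N V \<phi>"
    unfolding local_parametrization_def
  proof (intro conjI exI)
    show "open V" by (simp add: V_def)
    show "smooth_on V \<phi>" unfolding \<phi>_def by (rule smooth_on_affine[OF L])
    show "\<forall>u\<in>V. inj (frechet_derivative \<phi> (at u))" using d \<open>inj L\<close> by simp
    show "openin (top_of_set N) (\<phi> ` V)" by (simp add: N_def)
    show "homeomorphism V (\<phi> ` V) \<phi> \<psi>"
      using inv cont\<phi> cont\<psi> by (auto simp: homeomorphism_def image_image)
  qed
  have x: "\<phi> 0 = x" using \<open>linear L\<close> by (simp add: \<phi>_def linear_0)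
  have V0: "0 \<in> V" using r by (simp add: V_def)
  show ?thesis
  proof (rule that[of N])
    show "smooth_surface N" unfolding smooth_surface_def using par N_def by blast
    show "x \<in> N" using x V0 unfolding N_def by force
    show "N \<subseteq> U" using r unfolding N_def V_def by auto
    have "m \<bullet> L h = 0" for h by (simp add: L_def inner_add_right mp mq)
    then show "unit_normal N x m" unfolding unit_normal_def
      using m par V0 x d by (intro conjI exI[of _ V] exI[of _ \<phi>] exI[of _ 0]) auto
  qed
qed

text \<open>A disc small enough to lie in the flow domain is advected by the flow map. Extremality
  among material surfaces thereby becomes extremality among all unit vectors not parallel to
  \<open>n\<close>.\<close>

lemma competing_normalI:
  assumes x: "x \<in> interior (flow_domain D v t0 T)" and m: "norm m = 1"
    and nm: "\<not> collinear {0, n, m}"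
  shows "competing_normal D v t0 T x n m"
proof -
  obtain S where S: "smooth_surface S" "x \<in> S" "S \<subseteq> interior (flow_domain D v t0 T)" "unit_normal S x m"
    using planar_surface[OF open_interior x m] by blast
  have Sd: "S \<subseteq> flow_domain D v t0 T" using S(3) interior_subset by blast
  \<comment> \<open>No uniqueness of trajectories enters: at the initial time the described value is
    the prescribed initial point itself.\<close>
  have id: "flow_map D v t0 T t0 y = y" if "y \<in> flow_domain D v t0 T" for y
    unfolding flow_map_def using that by (intro the_equality) (auto simp: flow_domain_def)
  have eq: "flow_map D v t0 T t0 ` S = S" using id Sd by (force simp: image_iff)
  have "material_surface D v t0 T (\<lambda>t. flow_map D v t0 T t ` S)"
    unfolding material_surface_def using S(1) Sd by (simp add: eq)
  then show ?thesis
    unfolding competing_normal_def using S nm eq by (intro exI[of _ "\<lambda>t. flow_map D v t0 T t ` S"]) simp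
qed

section \<open>Uniqueness of the normal up to sign\<close>

text \<open>An explicit normal, available at every point of a chart and, before normalization,
  continuous in the parameter.\<close>

lemma unit_normal_param:
  assumes par: "local_parametrization S V \<phi>" and u: "u \<in> V"
  defines "c \<equiv> cross3 (frechet_derivative \<phi> (at u) (axis 1 1)) (frechet_derivative \<phi> (at u) (axis 2 1))"
  shows "c \<noteq> 0" "unit_normal S (\<phi> u) (c /\<^sub>R norm c)" "c \<bullet> frechet_derivative \<phi> (at u) h = 0"
proof -
  note lin = local_parametrizationD(5)[OF par u]
  show c0: "c \<noteq> 0"
    unfolding c_def by (rule cross_axis_nonzero[OF lin local_parametrizationD(3)[OF par u]])
  have orth: "c \<bullet> frechet_derivative \<phi> (at u) h = 0" for h
    unfolding c_def by (subst linear_axis_2[OF lin]) (simp add: inner_add_right dot_cross_self)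
  then show "c \<bullet> frechet_derivative \<phi> (at u) h = 0" .
  show "unit_normal S (\<phi> u) (c /\<^sub>R norm c)"
    unfolding unit_normal_def using c0 orth par u by auto
qed

text \<open>This condition does not mention a parametrization, so the tangent plane does not depend on it.\<close>

lemma normal_little_o:
  assumes par: "local_parametrization S V \<phi>" and u: "u \<in> V" and p: "\<phi> u = p"
    and n: "\<And>h. n \<bullet> frechet_derivative \<phi> (at u) h = 0" and e: "0 < e"
  shows "\<exists>d>0. \<forall>x\<in>S. norm (x - p) < d \<longrightarrow> \<bar>n \<bullet> (x - p)\<bar> \<le> e * norm (x - p)"
proof -
  define A where "A = frechet_derivative \<phi> (at u)"
  have A: "(\<phi> has_derivative A) (at u)" "linear A" "inj A"
    unfolding A_def using local_parametrizationD[OF par] u by blast+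
  obtain B where B: "B > 0" "\<And>h. B * norm h \<le> norm (A h)"
    using linear_inj_bounded_below_pos[OF A(2,3)] by metis
  \<comment> \<open>The first entry of the minimum makes (B / 2) |y - u| a lower bound for |x - p|;
    the second then makes the normal component at most e |x - p|.\<close>
  define c where "c = min (B / 2) (e * B / (2 * (norm n + 1)))"
  have n1: "norm n + 1 > 0" using norm_ge_zero[of n] by linarith
  have c: "c > 0" using B e n1 by (simp add: c_def)
  obtain d where d: "d > 0" "\<And>y. norm (y - u) < d \<Longrightarrow> norm (\<phi> y - \<phi> u - A (y - u)) \<le> c * norm (y - u)"
    using A(1) c unfolding has_derivative_at_alt by metis
  \<comment> \<open>Openness of the chart in \<open>S\<close> and continuity of the inverse ensure
    that all points of \<open>S\<close> near \<open>p\<close> have parameters near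
    \<open>u\<close>.\<close>
  obtain \<psi> where \<psi>: "homeomorphism V (\<phi> ` V) \<phi> \<psi>" using local_parametrizationD(7)[OF par] by blast
  have pV: "p \<in> \<phi> ` V" "\<psi> p = u" using p u homeomorphism_apply1[OF \<psi>] by auto
  obtain d1 where d1: "d1 > 0" "\<And>x. x \<in> S \<Longrightarrow> dist x p < d1 \<Longrightarrow> x \<in> \<phi> ` V"
    using local_parametrizationD(6)[OF par] pV(1) unfolding openin_euclidean_subtopology_iff by metis
  have "continuous_on (\<phi> ` V) \<psi>" using \<psi> by (simp add: homeomorphism_def)
  then obtain d2 where d2: "d2 > 0" "\<And>x. x \<in> \<phi> ` V \<Longrightarrow> dist x p < d2 \<Longrightarrow> dist (\<psi> x) (\<psi> p) < d"
    using d(1) pV(1) unfolding continuous_on_iff by metis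
  have "\<bar>n \<bullet> (x - p)\<bar> \<le> e * norm (x - p)" if x: "x \<in> S" "norm (x - p) < min d1 d2" for x
  proof -
    have xV: "x \<in> \<phi> ` V" using d1(2) x by (simp add: dist_norm)
    define y where "y = \<psi> x"
    have y: "\<phi> y = x" "norm (y - u) < d"
      using homeomorphism_apply2[OF \<psi> xV] d2(2)[OF xV] x pV by (auto simp: y_def dist_norm)
    have err: "norm (x - p - A (y - u)) \<le> c * norm (y - u)" using d(2)[OF y(2)] y(1) p by simp
    have "B * norm (y - u) \<le> norm (A (y - u))" by (rule B)
    also have "\<dots> \<le> norm (x - p) + norm (x - p - A (y - u))"
      using norm_triangle_ineq4[of "x - p" "x - p - A (y - u)"] by simp
    also have "\<dots> \<le> norm (x - p) + B / 2 * norm (y - u)"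
    proof -
      have "c \<le> B / 2" unfolding c_def by (rule min.cobounded1)
      then have "c * norm (y - u) \<le> B / 2 * norm (y - u)" by (rule mult_right_mono) simp
      then show ?thesis using err by linarith
    qed
    finally have 1: "B / 2 * norm (y - u) \<le> norm (x - p)" by simp
    have "n \<bullet> (x - p) = n \<bullet> (x - p - A (y - u))" using n by (simp add: A_def inner_diff_right)
    then have "\<bar>n \<bullet> (x - p)\<bar> \<le> norm n * norm (x - p - A (y - u))"
      by (metis Cauchy_Schwarz_ineq2)
    also have "\<dots> \<le> (norm n + 1) * (e * B / (2 * (norm n + 1)) * norm (y - u))"
    proof (rule mult_mono)
      have "c * norm (y - u) \<le> e * B / (2 * (norm n + 1)) * norm (y - u)"
        by (intro mult_right_mono) (auto simp: c_def)
      then show "norm (x - p - A (y - u)) \<le> e * B / (2 * (norm n + 1)) * norm (y - u)"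
        using err by linarith
    qed (use n1 in auto)
    also have "\<dots> = e * (B / 2 * norm (y - u))"
    proof -
      have "N * (e * B / (2 * N) * z) = e * (B / 2 * z)" if "N > 0" for N z :: real
        using that by simp
      then show ?thesis using n1 .
    qed
    also have "\<dots> \<le> e * norm (x - p)" using 1 e by (intro mult_left_mono) auto
    finally show ?thesis .
  qed
  then show ?thesis using d1(1) d2(1) by (intro exI[of _ "min d1 d2"]) auto
qed

text \<open>Moving along the second chart in direction \<open>h\<close> displaces the surface point
  by s A h + o(s). By \<open>normal_little_o\<close> the normal component of this displacement is
  o(s), which forces n to be orthogonal to A h.\<close>

lemma normal_independent_of_param:
  assumes par: "local_parametrization S V \<phi>" "u \<in> V" "\<phi> u = p"
    and par': "local_parametrization S V' \<phi>'" "u' \<in> V'" "\<phi>' u' = p"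
    and n: "\<And>h. n \<bullet> frechet_derivative \<phi> (at u) h = 0"
  shows "n \<bullet> frechet_derivative \<phi>' (at u') h = 0"
proof (rule ccontr)
  define A where "A = frechet_derivative \<phi>' (at u')"
  assume "n \<bullet> frechet_derivative \<phi>' (at u') h \<noteq> 0"
  then have nz: "\<bar>n \<bullet> A h\<bar> > 0" by (simp add: A_def)
  have A: "(\<phi>' has_derivative A) (at u')" "linear A"
    unfolding A_def using local_parametrizationD[OF par'(1)] par'(2) by blast+
  define c where "c = \<bar>n \<bullet> A h\<bar>"
  \<comment> \<open>\<open>M\<close> bounds |x - p| / s. With \<open>\<eta>\<close> the
    linearization error contributes at most s c / 4, and the tolerance c / (2 M) contributes s c /
    2, together less than s c.\<close>
  define M where "M = norm (A h) + norm h + 1"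
  define \<eta> where "\<eta> = min 1 (c / (4 * (norm n * norm h + 1)))"
  have M: "M > 0" "norm h < M" using norm_ge_zero[of h] norm_ge_zero[of "A h"] unfolding M_def by linarith+
  have nh: "norm n * norm h + 1 > 0" by (intro add_nonneg_pos mult_nonneg_nonneg) auto
  have c: "c > 0" using nz by (simp add: c_def)
  then have \<eta>: "\<eta> > 0" using nh by (simp add: \<eta>_def)
  obtain d where d: "d > 0" "\<And>x. x \<in> S \<Longrightarrow> norm (x - p) < d \<Longrightarrow> \<bar>n \<bullet> (x - p)\<bar> \<le> c / (2 * M) * norm (x - p)"
    using normal_little_o[OF par n, of "c / (2 * M)"] c M by auto
  obtain \<delta> where \<delta>: "\<delta> > 0"
    "\<And>y. norm (y - u') < \<delta> \<Longrightarrow> norm (\<phi>' y - p - A (y - u')) \<le> \<eta> * norm (y - u')"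
    using A(1) \<eta> unfolding has_derivative_at_alt par'(3) by metis
  obtain r where r: "r > 0" "ball u' r \<subseteq> V'"
    using local_parametrizationD(1)[OF par'(1)] par'(2) open_contains_ball by blast
  define s where "s = min \<delta> (min r d) / M"
  have s: "s > 0" using \<delta>(1) r(1) d(1) M by (simp add: s_def)
  have sM: "s * M = min \<delta> (min r d)" using M by (simp add: s_def)
  have "s * norm h < s * M" using s M by simp
  then have sh: "s * norm h < \<delta>" "s * norm h < r" unfolding sM by auto
  define x where "x = \<phi>' (u' + s *\<^sub>R h)"
  have "u' + s *\<^sub>R h \<in> V'" using r(2) sh(2) s by (auto simp: dist_norm)
  then have xS: "x \<in> S"
    using local_parametrizationD(6)[OF par'(1)] openin_imp_subset unfolding x_def by blast
  have err: "norm (x - p - s *\<^sub>R A h) \<le> \<eta> * (s * norm h)"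
    using \<delta>(2)[of "u' + s *\<^sub>R h"] sh(1) s linear_cmul[OF A(2)] by (simp add: x_def)
  also have "\<dots> \<le> 1 * (s * norm h)" using s by (intro mult_right_mono) (auto simp: \<eta>_def)
  finally have "norm (x - p - s *\<^sub>R A h) \<le> s * norm h" by simp
  then have "norm (x - p) \<le> s * norm (A h) + s * norm h"
    using norm_triangle_ineq[of "x - p - s *\<^sub>R A h" "s *\<^sub>R A h"] s by simp
  also have "\<dots> < s * M" using s by (simp add: M_def algebra_simps)
  finally have xp: "norm (x - p) < s * M" .
  have "s * c = \<bar>n \<bullet> (s *\<^sub>R A h)\<bar>" using s by (simp add: c_def abs_mult)
  also have "n \<bullet> (s *\<^sub>R A h) = n \<bullet> (x - p) - n \<bullet> (x - p - s *\<^sub>R A h)"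
    by (simp add: inner_diff_right)
  also have "\<bar>\<dots>\<bar> \<le> c / (2 * M) * norm (x - p) + norm n * norm (x - p - s *\<^sub>R A h)"
    using d(2)[OF xS] xp sM Cauchy_Schwarz_ineq2[of n "x - p - s *\<^sub>R A h"] by linarith
  also have "\<dots> \<le> c / (2 * M) * (s * M) + norm n * (c / (4 * (norm n * norm h + 1)) * (s * norm h))"
  proof (intro add_mono mult_left_mono)
    have "\<eta> * (s * norm h) \<le> c / (4 * (norm n * norm h + 1)) * (s * norm h)"
      using s by (intro mult_right_mono) (auto simp: \<eta>_def)
    then show "norm (x - p - s *\<^sub>R A h) \<le> c / (4 * (norm n * norm h + 1)) * (s * norm h)"
      using err by linarith
  qed (use xp c M in auto)
  also have "\<dots> = s * c / 2 + s * c / 4 * (norm n * norm h / (norm n * norm h + 1))"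
    using M by (simp add: field_simps)
  also have "\<dots> \<le> s * c / 2 + s * c / 4 * 1"
    using s c nh by (intro add_left_mono mult_left_mono) auto
  finally show False using s c by simp
qed

text \<open>Both normals are transferred to one chart, where each is a multiple of the same cross
  product; equal lengths leave only the sign.\<close>

lemma unit_normal_unique:
  assumes "unit_normal S p n" "unit_normal S p n'"
  shows "n' = n \<or> n' = - n"
proof -
  obtain V \<phi> u where par: "local_parametrization S V \<phi>" "u \<in> V" "\<phi> u = p"
    and n: "\<And>h. n \<bullet> frechet_derivative \<phi> (at u) h = 0" and n1: "norm n = 1"
    using assms(1) unfolding unit_normal_def by blast
  have n': "n' \<bullet> frechet_derivative \<phi> (at u) h = 0" "norm n' = 1" for h
    using assms(2) normal_independent_of_param[OF _ _ _ par] unfolding unit_normal_def by blast+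
  define c where "c = cross3 (frechet_derivative \<phi> (at u) (axis 1 1)) (frechet_derivative \<phi> (at u) (axis 2 1))"
  have c: "c \<noteq> 0" unfolding c_def by (rule unit_normal_param[OF par(1,2)])
  obtain a where a: "n = a *\<^sub>R c" using orthogonal_to_plane[OF c[unfolded c_def] n n] c_def by blast
  obtain b where b: "n' = b *\<^sub>R c" using orthogonal_to_plane[OF c[unfolded c_def] n'(1) n'(1)] c_def by blast
  have "\<bar>a\<bar> * norm c = \<bar>b\<bar> * norm c" using n1 n'(2) by (simp add: a b)
  then have "a = b \<or> a = - b" using c by (auto simp: abs_eq_iff)
  then show ?thesis by (auto simp: a b)
qed

section \<open>Coherent structures\<close>

text \<open>Normality is required only on a relative neighbourhood, because frames are local and the
  sign of the shear field is at first only locally constant. The chart is restricted to the preimage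
  of that neighbourhood.\<close>

lemma helicity_surface:
  assumes S: "smooth_surface S" and N: "openin (top_of_set S) N" "p \<in> N"
    and r: "r differentiable (at p)"
    and normal: "\<And>y n. y \<in> N \<Longrightarrow> unit_normal S y n \<Longrightarrow> \<exists>c. r y = c *\<^sub>R n"
  shows "helicity r p = 0"
proof -
  have pS: "p \<in> S" using N openin_imp_subset by blast
  then obtain V \<phi> where par: "local_parametrization S V \<phi>" and "p \<in> \<phi> ` V"
    using S unfolding smooth_surface_def by blast
  then obtain u where u: "u \<in> V" "\<phi> u = p" by blast
  note \<phi> = local_parametrizationD[OF par]
  obtain G where G: "open G" "N = S \<inter> G" using N(1) unfolding openin_open by blast
  define V' where "V' = V \<inter> \<phi> -` G"
  have "open V'"
    unfolding V'_def using \<phi>(1) G(1) Ck_on_imp_continuous_on[OF \<phi>(2)]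
    by (intro continuous_open_preimage)
  have sub: "\<phi> ` V \<subseteq> S" using \<phi>(6) openin_imp_subset by blast
  have "r (\<phi> y) \<bullet> frechet_derivative \<phi> (at y) h = 0" if y: "y \<in> V'" for y h
  proof -
    have yV: "y \<in> V" and "\<phi> y \<in> N" using y sub by (auto simp: V'_def G)
    then obtain c where "r (\<phi> y) = c *\<^sub>R (cross3 (frechet_derivative \<phi> (at y) (axis 1 1))
        (frechet_derivative \<phi> (at y) (axis 2 1)) /\<^sub>R
        norm (cross3 (frechet_derivative \<phi> (at y) (axis 1 1)) (frechet_derivative \<phi> (at y) (axis 2 1))))"
      using normal unit_normal_param(2)[OF par yV] by blast
    then show ?thesis using unit_normal_param(3)[OF par yV, of h] by simp
  qed
  moreover have "u \<in> V'" using u N by (simp add: V'_def G)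
  moreover have "Ck_on (Suc (Suc 0)) V' \<phi>" using \<phi>(2) by (rule Ck_on_subset) (auto simp: V'_def)
  ultimately show ?thesis
    using helicity_normal_field[OF \<open>open V'\<close>, of u \<phi> r] \<phi>(3) u r by blast
qed

lemma smooth_strain_frame_strain:
  assumes "smooth_strain_frame D v t0 T V \<xi>" "x \<in> V"
  shows "strain D v t0 T x (strain_eigenvalues D v t0 T x) (\<lambda>i. \<xi> i x)"
  using assms unfolding smooth_strain_frame_def simple_strain_set_def Let_def
  by unfold_locales auto

lemma smooth_strain_frameD:
  assumes "smooth_strain_frame D v t0 T V \<xi>"
  shows "open V" "x \<in> V \<Longrightarrow> x \<in> interior (flow_domain D v t0 T)"
    "x \<in> V \<Longrightarrow> \<xi> i differentiable (at x)" "continuous_on V (\<xi> i)"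
proof -
  have "Ck_on (Suc 0) V (\<xi> i)" using assms unfolding smooth_strain_frame_def smooth_on_def by blast
  then show "x \<in> V \<Longrightarrow> \<xi> i differentiable (at x)" "continuous_on V (\<xi> i)"
    by (simp, rule Ck_on_imp_continuous_on)
  show "open V" "x \<in> V \<Longrightarrow> x \<in> interior (flow_domain D v t0 T)"
    using assms unfolding smooth_strain_frame_def simple_strain_set_def by auto
qed

section \<open>Differentiability of the eigenvalues and of the shear normals\<close>

lemma differentiable_vec_nth:
  fixes f :: "'a::real_normed_vector \<Rightarrow> 'b::real_normed_vector^'n"
  assumes "f differentiable (at x)"
  shows "(\<lambda>x. f x $ i) differentiable (at x)"
  using differentiable_compose[OF bounded_linear_imp_differentiable[OF bounded_linear_vec_nth] assms] .

lemma differentiable_sqrt: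
  fixes f :: "'a::real_normed_vector \<Rightarrow> real"
  assumes "f differentiable (at x)" "0 < f x"
  shows "(\<lambda>x. sqrt (f x)) differentiable (at x)"
  using assms has_derivative_real_sqrt unfolding differentiable_def by blast

text \<open>The i-th eigenvalue is |F \<xi>_i|^2, a polynomial in the entries of F and \<xi>_i, so
  with a given smooth frame no perturbation theory of eigenvalues is involved.\<close>

lemma strain_eigenvalues_differentiable:
  assumes flow: "compact D" "T > 0" "smooth_velocity D v t0 T"
    and frame: "smooth_strain_frame D v t0 T V \<xi>" and x: "x \<in> V"
  shows "(\<lambda>x. strain_eigenvalues D v t0 T x $ i) differentiable (at x)"
proof -
  let ?F = "flow_gradient D v t0 T"
  note \<xi> = smooth_strain_frameD[OF frame]
  have F: "?F differentiable (at x)"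
    by (rule flow_gradient_differentiable[OF flow \<xi>(2)[OF x]])
  have "(\<lambda>x. \<Sum>k\<in>UNIV. (\<Sum>j\<in>UNIV. ?F x $ k $ j * \<xi> i x $ j) * (\<Sum>j\<in>UNIV. ?F x $ k $ j * \<xi> i x $ j))
      differentiable (at x)"
    by (intro differentiable_sum differentiable_mult differentiable_vec_nth F \<xi>(3)[OF x] ballI finite)
  then show ?thesis
  proof (rule differentiable_cong_open[OF _ \<xi>(1) x])
    fix y assume "y \<in> V"
    then interpret strain D v t0 T y "strain_eigenvalues D v t0 T y" "\<lambda>i. \<xi> i y"
      by (rule smooth_strain_frame_strain[OF frame])
    show "(\<Sum>k\<in>UNIV. (\<Sum>j\<in>UNIV. ?F y $ k $ j * \<xi> i y $ j) * (\<Sum>j\<in>UNIV. ?F y $ k $ j * \<xi> i y $ j))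
        = strain_eigenvalues D v t0 T y $ i"
      using inner_F_e[of i i] by (simp add: inner_vec_def matrix_vector_mult_def)
  qed
qed

text \<open>Strict positivity of the eigenvalues keeps the arguments of all the nested square roots
  away from 0.\<close>

lemma shear_normal_differentiable:
  assumes flow: "compact D" "T > 0" "smooth_velocity D v t0 T"
    and frame: "smooth_strain_frame D v t0 T V \<xi>" and x: "x \<in> V"
  shows "shear_normal D v t0 T \<xi> s differentiable (at x)"
proof -
  interpret strain D v t0 T x "strain_eigenvalues D v t0 T x" "\<lambda>i. \<xi> i x"
    by (rule smooth_strain_frame_strain[OF frame x])
  let ?l = "strain_eigenvalues D v t0 T"
  have pos: "0 < sqrt (?l x $ i)" for i using l_positive by simp
  have sq: "(\<lambda>x. sqrt (?l x $ i)) differentiable (at x)" for i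
    using strain_eigenvalues_differentiable[OF flow frame x] l_positive by (rule differentiable_sqrt)
  have quot: "(\<lambda>x. sqrt (sqrt (?l x $ i) / (sqrt (?l x $ 1) + sqrt (?l x $ 3)))) differentiable (at x)" for i
  proof (rule differentiable_sqrt)
    show "(\<lambda>x. sqrt (?l x $ i) / (sqrt (?l x $ 1) + sqrt (?l x $ 3))) differentiable (at x)"
      using add_pos_pos[OF pos[of 1] pos[of 3]]
      by (intro differentiable_divide differentiable_add sq) (metis less_irrefl)
    show "0 < sqrt (?l x $ i) / (sqrt (?l x $ 1) + sqrt (?l x $ 3))"
      using pos by (intro divide_pos_pos add_pos_pos)
  qed
  have "(\<lambda>x. sqrt (sqrt (?l x $ 1) / (sqrt (?l x $ 1) + sqrt (?l x $ 3))) *\<^sub>R \<xi> 1 x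
      + (s * sqrt (sqrt (?l x $ 3) / (sqrt (?l x $ 1) + sqrt (?l x $ 3)))) *\<^sub>R \<xi> 3 x) differentiable (at x)"
    by (intro differentiable_add differentiable_scaleR differentiable_mult differentiable_const quot
        smooth_strain_frameD(3)[OF frame x])
  then show ?thesis unfolding shear_normal_def[abs_def] Let_def .
qed

section \<open>Normals of coherent structures relative to a local frame\<close>

locale framed_surface =
  fixes D :: "(real^3) set" and v :: "real^3 \<Rightarrow> real \<Rightarrow> real^3" and t0 T :: real
    and M :: "real \<Rightarrow> (real^3) set" and V :: "(real^3) set" and \<xi> :: "3 \<Rightarrow> real^3 \<Rightarrow> real^3"
  assumes flow: "compact D" "T > 0" "smooth_velocity D v t0 T"
    and surface: "smooth_surface (M t0)"
    and frame: "smooth_strain_frame D v t0 T V \<xi>"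
begin

lemma openin_frame: "openin (top_of_set (M t0)) (M t0 \<inter> V)"
  using smooth_strain_frameD(1)[OF frame] by (rule openin_open_Int)

lemma competitor:
  assumes "x \<in> V" "norm m = 1" "\<not> collinear {0, n, m}"
  shows "competing_normal D v t0 T x n m"
  using competing_normalI smooth_strain_frameD(2)[OF frame] assms by blast

text \<open>If \<xi>_3 were not parallel to the normal, it would be an admissible competitor with
  strictly smaller repulsion, against the bound \<rho>(n) \<le> \<rho>(\<xi>_3). The attracting case
  is the mirror image with \<xi>_1.\<close>

lemma repelling_normal:
  assumes "repelling_LCS D v t0 T M" "x \<in> M t0 \<inter> V" "unit_normal (M t0) x n"
  shows "\<exists>c. \<xi> 3 x = c *\<^sub>R n"
proof (rule ccontr)
  assume neg: "\<nexists>c. \<xi> 3 x = c *\<^sub>R n"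
  interpret strain D v t0 T x "strain_eigenvalues D v t0 T x" "\<lambda>i. \<xi> i x"
    using smooth_strain_frame_strain[OF frame] assms(2) by blast
  have n1: "norm n = 1" using assms(3) by (simp add: unit_normal_def)
  then have "\<not> collinear {0, n, \<xi> 3 x}"
    using neg norm_e[of 3] unfolding collinear_lemma by auto
  then have "normal_repulsion D v t0 T x (\<xi> 3 x) < normal_repulsion D v t0 T x n"
    using assms competitor norm_e[of 3] unfolding repelling_LCS_def by blast
  then show False using repulsion_bounds(2)[OF n1] by simp
qed

lemma attracting_normal:
  assumes "attracting_LCS D v t0 T M" "x \<in> M t0 \<inter> V" "unit_normal (M t0) x n"
  shows "\<exists>c. \<xi> 1 x = c *\<^sub>R n"
proof (rule ccontr)
  assume neg: "\<nexists>c. \<xi> 1 x = c *\<^sub>R n"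
  interpret strain D v t0 T x "strain_eigenvalues D v t0 T x" "\<lambda>i. \<xi> i x"
    using smooth_strain_frame_strain[OF frame] assms(2) by blast
  have n1: "norm n = 1" using assms(3) by (simp add: unit_normal_def)
  then have "\<not> collinear {0, n, \<xi> 1 x}"
    using neg norm_e[of 1] unfolding collinear_lemma by auto
  then have "normal_repulsion D v t0 T x n < normal_repulsion D v t0 T x (\<xi> 1 x)"
    using assms competitor norm_e[of 1] unfolding attracting_LCS_def by blast
  then show False using repulsion_bounds(1)[OF n1] by simp
qed

lemma shear_LCS_normal:
  assumes "shear_LCS D v t0 T M" "x \<in> M t0 \<inter> V" "unit_normal (M t0) x n"
  shows "(n \<bullet> \<xi> 1 x) * (n \<bullet> \<xi> 3 x) \<noteq> 0"
    "\<exists>c. shear_normal D v t0 T \<xi> (sgn ((n \<bullet> \<xi> 1 x) * (n \<bullet> \<xi> 3 x))) x = c *\<^sub>R n"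
proof -
  interpret strain D v t0 T x "strain_eigenvalues D v t0 T x" "\<lambda>i. \<xi> i x"
    using smooth_strain_frame_strain[OF frame] assms(2) by blast
  have n1: "norm n = 1" using assms(3) by (simp add: unit_normal_def)
  have "tangential_shear D v t0 T x m \<le> tangential_shear D v t0 T x n"
    if "norm m = 1" "\<not> collinear {0, n, m}" for m
    using assms competitor that unfolding shear_LCS_def by blast
  note ext = shear_extremal[OF n1 this]
  show "(n \<bullet> \<xi> 1 x) * (n \<bullet> \<xi> 3 x) \<noteq> 0" using ext(1) .
  show "\<exists>c. shear_normal D v t0 T \<xi> (sgn ((n \<bullet> \<xi> 1 x) * (n \<bullet> \<xi> 3 x))) x = c *\<^sub>R n"
    using ext(2) unfolding shear_normal_def Let_def shear_direction_def .
qed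

text \<open>The product does not change when \<open>n\<close> is replaced by \<open>- n\<close>, so the choice of the unit normal is
  immaterial.\<close>

definition shear_sign :: "real^3 \<Rightarrow> real" where
  "shear_sign x = (let n = SOME n. unit_normal (M t0) x n in sgn ((n \<bullet> \<xi> 1 x) * (n \<bullet> \<xi> 3 x)))"

lemma shear_sign_eq:
  assumes "unit_normal (M t0) x n"
  shows "shear_sign x = sgn ((n \<bullet> \<xi> 1 x) * (n \<bullet> \<xi> 3 x))"
proof -
  define n' where "n' = (SOME n. unit_normal (M t0) x n)"
  have "unit_normal (M t0) x n'" unfolding n'_def using assms by (rule someI)
  then have "n' = n \<or> n' = - n" using unit_normal_unique[OF assms] by blast
  then show ?thesis unfolding shear_sign_def Let_def n'_def[symmetric] by auto
qed

text \<open>In a chart the sign is that of a continuous function without zeros, hence constant where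
  that function keeps the sign it has at the base point. The chart carries this open parameter set
  to a relatively open part of the surface.\<close>

lemma shear_sign_locally_constant:
  assumes shear: "shear_LCS D v t0 T M" and p: "p \<in> M t0 \<inter> V"
  obtains N where "openin (top_of_set (M t0)) N" "p \<in> N" "N \<subseteq> V" "\<And>y. y \<in> N \<Longrightarrow> shear_sign y = shear_sign p"
proof -
  obtain W \<phi> where par: "local_parametrization (M t0) W \<phi>" and "p \<in> \<phi> ` W"
    using surface p unfolding smooth_surface_def by blast
  then obtain u where u: "u \<in> W" "\<phi> u = p" by blast
  note \<phi> = local_parametrizationD[OF par]
  define c where "c = (\<lambda>y. cross3 (frechet_derivative \<phi> (at y) (axis 1 1)) (frechet_derivative \<phi> (at y) (axis 2 1)))"
  \<comment> \<open>The unnormalized normal is used; normalizing divides \<open>f\<close> by |c|^2 >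
    0 and leaves the sign alone.\<close>
  define f where "f = (\<lambda>y. (c y \<bullet> \<xi> 1 (\<phi> y)) * (c y \<bullet> \<xi> 3 (\<phi> y)))"
  define W1 where "W1 = W \<inter> \<phi> -` V"
  have cont\<phi>: "continuous_on W \<phi>" using Ck_on_imp_continuous_on[OF \<phi>(2)] .
  have W1: "open W1"
    unfolding W1_def using \<phi>(1) smooth_strain_frameD(1)[OF frame] cont\<phi> by (intro continuous_open_preimage)
  have "continuous_on W1 (\<lambda>y. frechet_derivative \<phi> (at y) h)" for h
    using \<phi>(2)[of "Suc 0"] by (auto simp: W1_def intro: continuous_on_subset)
  then have "continuous_on W1 c" unfolding c_def by (intro continuous_on_cross)
  moreover have "continuous_on W1 (\<lambda>y. \<xi> i (\<phi> y))" for i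
    by (rule continuous_on_compose2[OF smooth_strain_frameD(4)[OF frame] continuous_on_subset[OF cont\<phi>]])
      (auto simp: W1_def)
  ultimately have contf: "continuous_on W1 f" unfolding f_def by (intro continuous_intros)
  have sub: "\<phi> ` W \<subseteq> M t0" using \<phi>(6) openin_imp_subset by blast
  have sign: "f y \<noteq> 0 \<and> shear_sign (\<phi> y) = sgn (f y)" if y: "y \<in> W1" for y
  proof -
    have yW: "y \<in> W" "\<phi> y \<in> M t0 \<inter> V" using y sub by (auto simp: W1_def)
    have c: "c y \<noteq> 0" "unit_normal (M t0) (\<phi> y) (c y /\<^sub>R norm (c y))"
      unfolding c_def by (rule unit_normal_param[OF par yW(1)])+
    have eq: "((c y /\<^sub>R norm (c y)) \<bullet> \<xi> 1 (\<phi> y)) * ((c y /\<^sub>R norm (c y)) \<bullet> \<xi> 3 (\<phi> y)) = f y / (norm (c y))\<^sup>2"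
      by (simp add: f_def power2_eq_square divide_inverse)
    show ?thesis
      using shear_LCS_normal(1)[OF shear yW(2) c(2)] shear_sign_eq[OF c(2)] c(1) unfolding eq
      by (simp add: sgn_divide)
  qed
  define W2 where "W2 = W1 \<inter> (\<lambda>y. f u * f y) -` {0<..}"
  have "open W2" unfolding W2_def
    using W1 contf by (intro continuous_open_preimage continuous_intros) auto
  have uW1: "u \<in> W1" using u p by (simp add: W1_def)
  obtain \<psi> where "homeomorphism W (\<phi> ` W) \<phi> \<psi>" using \<phi>(7) by blast
  moreover have "openin (top_of_set W) W2"
    using \<open>open W2\<close> by (rule open_subset[rotated]) (auto simp: W2_def W1_def)
  ultimately have "openin (top_of_set (\<phi> ` W)) (\<phi> ` W2)"
    by (rule homeomorphism_imp_open_map)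
  then have "openin (top_of_set (M t0)) (\<phi> ` W2)" using \<phi>(6) by (rule openin_trans)
  moreover have "p \<in> \<phi> ` W2"
  proof -
    have "f u * f u > 0" using sign[OF uW1] by (simp add: zero_less_mult_iff) linarith
    then show ?thesis using uW1 u by (auto simp: W2_def)
  qed
  moreover have "\<phi> ` W2 \<subseteq> V" by (auto simp: W2_def W1_def)
  moreover have "shear_sign y = shear_sign p" if im: "y \<in> \<phi> ` W2" for y
  proof -
    obtain z where "z \<in> W2" and y: "y = \<phi> z" using im by blast
    then have z: "z \<in> W1" "f u * f z > 0" by (simp_all add: W2_def)
    then have "sgn (f z) = sgn (f u)" by (auto simp: zero_less_mult_iff)
    then show ?thesis using sign[OF z(1)] sign[OF uW1] u(2) y by simp
  qed
  ultimately show ?thesis by (rule that)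
qed

text \<open>Freezing the sign at its value at \<open>p\<close> gives a differentiable field, and
  local constancy makes this field normal to the surface around \<open>p\<close>, not merely at
  \<open>p\<close>.\<close>

lemma shear_helicity:
  assumes shear: "shear_LCS D v t0 T M" and p: "p \<in> M t0 \<inter> V"
  shows "helicity (shear_normal D v t0 T \<xi> (shear_sign p)) p = 0"
proof -
  obtain N where N: "openin (top_of_set (M t0)) N" "p \<in> N" "N \<subseteq> V"
    "\<And>y. y \<in> N \<Longrightarrow> shear_sign y = shear_sign p"
    using shear_sign_locally_constant[OF shear p] by blast
  show ?thesis
  proof (rule helicity_surface[OF surface N(1,2)])
    show "shear_normal D v t0 T \<xi> (shear_sign p) differentiable (at p)"
      using shear_normal_differentiable[OF flow frame] p by blast
    fix y n assume y: "y \<in> N" and n: "unit_normal (M t0) y n"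
    have "y \<in> M t0 \<inter> V" using y N openin_imp_subset by blast
    then show "\<exists>c. shear_normal D v t0 T \<xi> (shear_sign p) y = c *\<^sub>R n"
      using shear_LCS_normal(2)[OF shear _ n] shear_sign_eq[OF n] N(4)[OF y] by simp
  qed
qed

lemma shear_sign_constant:
  assumes shear: "shear_LCS D v t0 T M" and S: "connected S" "S \<subseteq> M t0 \<inter> V"
  obtains s where "s \<in> {1, -1}" "\<And>x. x \<in> S \<Longrightarrow> shear_sign x = s"
proof (cases "S = {}")
  case True
  then show ?thesis using that[of 1] by simp
next
  case False
  then obtain a where a: "a \<in> S" by blast
  have "shear_sign constant_on S"
  proof (rule locally_constant_imp_constant[OF S(1)])
    fix b assume b: "b \<in> S"
    then have "b \<in> M t0 \<inter> V" using S(2) by blast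
    then obtain N where N: "openin (top_of_set (M t0)) N" "b \<in> N"
      "\<And>y. y \<in> N \<Longrightarrow> shear_sign y = shear_sign b"
      using shear_sign_locally_constant[OF shear] by metis
    obtain G where "open G" "N = M t0 \<inter> G" using N(1) unfolding openin_open by blast
    then have "openin (top_of_set S) (S \<inter> G)" "S \<inter> G \<subseteq> N" using S(2) by (auto intro: openin_open_Int)
    moreover have "b \<in> S \<inter> G" using b N(2) \<open>N = M t0 \<inter> G\<close> by blast
    ultimately show "\<exists>R. openin (top_of_set S) R \<and> b \<in> R \<and> (\<forall>x\<in>R. shear_sign x = shear_sign b)"
      using N(3) by blast
  qed
  then have const: "shear_sign x = shear_sign a" if "x \<in> S" for x
    using a that unfolding constant_on_def by metis
  \<comment> \<open>A chart supplies an actual normal at \<open>a\<close>; only with it can the sign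
    be shown to be nonzero.\<close>
  have "a \<in> M t0" using a S(2) by blast
  then obtain W \<phi> where "local_parametrization (M t0) W \<phi>" "a \<in> \<phi> ` W"
    using surface unfolding smooth_surface_def by blast
  then obtain n where n: "unit_normal (M t0) a n" using unit_normal_param(2) by blast
  have "a \<in> M t0 \<inter> V" using a S(2) by blast
  then have "shear_sign a \<in> {1, -1}"
    using shear_LCS_normal(1)[OF shear _ n] unfolding shear_sign_eq[OF n] by (auto simp: sgn_real_def)
  then show ?thesis using that const by blast
qed

end

theorem theorem2:
  fixes D :: "(real^3) set" and v :: "real^3 \<Rightarrow> real \<Rightarrow> real^3"
    and t0 T :: real and M :: "real \<Rightarrow> (real^3) set"
  assumes "compact D" and "T > 0" and "smooth_velocity D v t0 T"
    and "material_surface D v t0 T M"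
    and "M t0 \<subseteq> simple_strain_set D v t0 T"
  shows "(repelling_LCS D v t0 T M \<longrightarrow>
           (\<forall>V \<xi>. smooth_strain_frame D v t0 T V \<xi> \<longrightarrow>
             (\<forall>x0 \<in> M t0 \<inter> V. helicity (\<xi> 3) x0 = 0))) \<and>
         (attracting_LCS D v t0 T M \<longrightarrow>
           (\<forall>V \<xi>. smooth_strain_frame D v t0 T V \<xi> \<longrightarrow>
             (\<forall>x0 \<in> M t0 \<inter> V. helicity (\<xi> 1) x0 = 0))) \<and>
         (shear_LCS D v t0 T M \<longrightarrow>
           (\<forall>V \<xi> S. smooth_strain_frame D v t0 T V \<xi> \<and> S \<subseteq> M t0 \<inter> V \<and> connected S \<longrightarrow>
             (\<exists>s\<in>{1, -1}. \<forall>x0\<in>S. helicity (shear_normal D v t0 T \<xi> s) x0 = 0)))"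
proof (intro conjI impI allI ballI)
  have surface: "smooth_surface (M t0)" using assms(4) by (simp add: material_surface_def)
  fix V \<xi> x assume LCS: "repelling_LCS D v t0 T M" and frame: "smooth_strain_frame D v t0 T V \<xi>"
    and x: "x \<in> M t0 \<inter> V"
  interpret framed_surface D v t0 T M V \<xi>
    by unfold_locales (rule assms surface frame)+
  show "helicity (\<xi> 3) x = 0"
    using helicity_surface[OF surface openin_frame x smooth_strain_frameD(3)[OF frame]] x
      repelling_normal[OF LCS] by blast
next
  have surface: "smooth_surface (M t0)" using assms(4) by (simp add: material_surface_def)
  fix V \<xi> x assume LCS: "attracting_LCS D v t0 T M" and frame: "smooth_strain_frame D v t0 T V \<xi>"
    and x: "x \<in> M t0 \<inter> V"
  interpret framed_surface D v t0 T M V \<xi>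
    by unfold_locales (rule assms surface frame)+
  show "helicity (\<xi> 1) x = 0"
    using helicity_surface[OF surface openin_frame x smooth_strain_frameD(3)[OF frame]] x
      attracting_normal[OF LCS] by blast
next
  have surface: "smooth_surface (M t0)" using assms(4) by (simp add: material_surface_def)
  fix V \<xi> S assume LCS: "shear_LCS D v t0 T M"
    and S: "smooth_strain_frame D v t0 T V \<xi> \<and> S \<subseteq> M t0 \<inter> V \<and> connected S"
  interpret framed_surface D v t0 T M V \<xi>
    by unfold_locales (use assms surface S in auto)
  obtain s where "s \<in> {1, -1}" "\<And>x. x \<in> S \<Longrightarrow> shear_sign x = s"
    using shear_sign_constant[OF LCS] S by blast
  then show "\<exists>s\<in>{1, -1}. \<forall>x0\<in>S. helicity (shear_normal D v t0 T \<xi> s) x0 = 0"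
    using shear_helicity[OF LCS] S by (metis subsetD)
qed

end
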